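(* Let $d\ge 1$, let $\lambda$ be a $\log$-concave probability measure on $\mathbb{R}^d$ with bounded support, let $\rho$ be a probability measure on $\mathbb{R}^d$ absolutely continuous with respect to $\lambda$, with density bounded from above and below by strictly positive constants, let $\mathcal{Y}\subseteq\mathbb{R}^d$ be compact and let $p>1$. Then there exists a constant $C=C(\lambda,\rho,\mathcal{Y},p)<\infty$ such that, for any probability measures $\mu,\nu$ supported on $\mathcal{Y}$, $$\|\phi_\mu-\phi_\nu\|_{L^2(\rho)}\le C\,\mathcal{W}_1(\mu,\nu)^{\theta},\qquad \theta=\begin{cases}1-\frac1p & \text{if } 1<p<2,\\ \frac12 & \text{if } p\ge 2,\end{cases}$$ where $(\phi_\mu,\psi_\mu)$ denotes the Kantorovich potentials for $\mathcal{W}_p(\rho,\mu)$ with zero $\rho$-mean, i.e. $\int\phi_\mu\,d\rho=0$, and similarly $(\phi_\nu,\psi_\nu)$ denotes the Kantorovich potentials for $\mathcal{W}_p(\rho,\nu)$ with $\int\phi_\nu\,d\rho=0$.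
   Context: $|\cdot|$ is the Euclidean norm on $\mathbb{R}^d$. For $p\ge1$ and probability measures $\rho,\mu$ on $\mathbb{R}^d$ with finite $p$-th moment, $\mathcal{W}_p(\rho,\mu):=\inf_{\pi\in\Pi(\rho,\mu)}\left(\int|y-x|^p\,d\pi(x,y)\right)^{1/p}$, where $\Pi(\rho,\mu)$ is the set of probability measures on $\mathbb{R}^d\times\mathbb{R}^d$ with marginals $\rho$ and $\mu$. Duality reads $\mathcal{W}_p(\rho,\mu)^p=\sup_{(\phi,\psi)}\left\{\int\phi\,d\rho+\int\psi\,d\mu\right\}$, where the supremum runs among upper semi-continuous functions $(\phi,\psi)$ such that $\phi(x)+\psi(y)\le|x-y|^p$ for every $x,y\in\mathbb{R}^d$. A pair $(\phi,\psi)$ attaining the supremum is called an optimal (or Kantorovich) pair of potentials for $\mathcal{W}_p(\rho,\mu)$; in the present setting the Kantorovich potential $\phi$ with zero $\rho$-mean is unique. A measure $\lambda$ on $\mathbb{R}^d$ is $\log$-concave if it has a density (with respect to the Lebesgue measure) of the form $e^{-V}$ with $V:\mathbb{R}^d\to(-\infty,\infty]$ convex and lower semicontinuous. *)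

theory Defs
  imports "HOL-Probability.Probability"
begin

text \<open>
  The space \<open>\<real>\<^sup>d\<close> with \<open>d \<ge> 1\<close> is a type of class \<^class>\<open>euclidean_space\<close>. Extended-valued functions
  take values in \<^typ>\<open>ereal\<close>; the excluded infinite value is ruled out explicitly where needed.
\<close>

definition lower_semicontinuous :: "('a::topological_space \<Rightarrow> ereal) \<Rightarrow> bool" where
  "lower_semicontinuous f \<longleftrightarrow> (\<forall>a. open {x. a < f x})"

definition upper_semicontinuous :: "('a::topological_space \<Rightarrow> ereal) \<Rightarrow> bool" where
  "upper_semicontinuous f \<longleftrightarrow> (\<forall>a. open {x. f x < a})"

text \<open>Meant for functions avoiding \<open>-\<infinity>\<close>, for which the right-hand side is never \<open>\<infinity> - \<infinity>\<close>.\<close>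

definition ereal_convex :: "('a::real_vector \<Rightarrow> ereal) \<Rightarrow> bool" where
  "ereal_convex V \<longleftrightarrow> (\<forall>x y. \<forall>t::real. 0 \<le> t \<and> t \<le> 1 \<longrightarrow>
     V ((1 - t) *\<^sub>R x + t *\<^sub>R y) \<le> ereal (1 - t) * V x + ereal t * V y)"

definition exp_minus :: "ereal \<Rightarrow> real" where
  "exp_minus v = (if v = \<infinity> then 0 else exp (- real_of_ereal v))"

definition log_concave_measure :: "'a::euclidean_space measure \<Rightarrow> bool" where
  "log_concave_measure M \<longleftrightarrow> (\<exists>V. (\<forall>x. V x \<noteq> -\<infinity>) \<and> ereal_convex V \<and> lower_semicontinuous V \<and>
     M = density lborel (\<lambda>x. ennreal (exp_minus (V x))))"

definition measure_support :: "'a::topological_space measure \<Rightarrow> 'a set" where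
  "measure_support M = {x. \<forall>U. open U \<and> x \<in> U \<longrightarrow> emeasure M U > 0}"

text \<open>Having a density with respect to \<open>M\<close> already entails absolute continuity.\<close>

definition has_density_bounded_above_below :: "'a measure \<Rightarrow> 'a measure \<Rightarrow> bool" where
  "has_density_bounded_above_below M N \<longleftrightarrow> (\<exists>f::'a \<Rightarrow> real. \<exists>a>0. \<exists>b>0. f \<in> borel_measurable M \<and>
     N = density M (\<lambda>x. ennreal (f x)) \<and> (AE x in M. a \<le> f x \<and> f x \<le> b))"

definition borel_prob :: "'a::topological_space measure \<Rightarrow> bool" where
  "borel_prob M \<longleftrightarrow> prob_space M \<and> sets M = sets borel"

definition couplings ::
  "'a::euclidean_space measure \<Rightarrow> 'a measure \<Rightarrow> ('a \<times> 'a) measure set" where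
  "couplings \<rho> \<mu> = {\<pi>. borel_prob \<pi> \<and> distr \<pi> borel fst = \<rho> \<and> distr \<pi> borel snd = \<mu>}"

text \<open>
  Only meant for probability measures with finite \<open>p\<close>-th moment; then the integrand is integrable
  under every coupling, so the Bochner integral is the true cost, and the infimum is over a
  nonempty set of nonnegative reals.
\<close>

definition wasserstein :: "real \<Rightarrow> 'a::euclidean_space measure \<Rightarrow> 'a measure \<Rightarrow> real" where
  "wasserstein p \<rho> \<mu> =
     (INF \<pi>\<in>couplings \<rho> \<mu>. (\<integral>z. norm (snd z - fst z) powr p \<partial>\<pi>) powr (1 / p))"

definition ereal_integrable :: "'a measure \<Rightarrow> ('a \<Rightarrow> ereal) \<Rightarrow> bool" where
  "ereal_integrable M f \<longleftrightarrow> (AE x in M. \<bar>f x\<bar> \<noteq> \<infinity>) \<and> integrable M (\<lambda>x. real_of_ereal (f x))"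

definition ereal_integral :: "'a measure \<Rightarrow> ('a \<Rightarrow> ereal) \<Rightarrow> real" where
  "ereal_integral M f = (\<integral>x. real_of_ereal (f x) \<partial>M)"

text \<open>
  Potentials are upper semicontinuous with values in \<open>[-\<infinity>, \<infinity>)\<close>; in particular real-valued ones are
  included. For measures with finite \<open>p\<close>-th moment the constraint bounds the positive parts of both
  potentials by integrable functions (unless one potential is identically \<open>-\<infinity>\<close>), so a pair that
  is not integrable has dual value \<open>-\<infinity>\<close>. Requiring integrability hence changes neither the
  supremum nor the set of maximisers.
\<close>

definition admissible_pair ::
  "real \<Rightarrow> 'a::euclidean_space measure \<Rightarrow> 'a measure \<Rightarrow> ('a \<Rightarrow> ereal) \<Rightarrow> ('a \<Rightarrow> ereal) \<Rightarrow> bool" where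
  "admissible_pair p \<rho> \<mu> \<phi> \<psi> \<longleftrightarrow>
     upper_semicontinuous \<phi> \<and> upper_semicontinuous \<psi> \<and>
     (\<forall>x. \<phi> x \<noteq> \<infinity>) \<and> (\<forall>y. \<psi> y \<noteq> \<infinity>) \<and>
     (\<forall>x y. \<phi> x + \<psi> y \<le> ereal (norm (x - y) powr p)) \<and>
     ereal_integrable \<rho> \<phi> \<and> ereal_integrable \<mu> \<psi>"

definition kantorovich_potentials ::
  "real \<Rightarrow> 'a::euclidean_space measure \<Rightarrow> 'a measure \<Rightarrow> ('a \<Rightarrow> ereal) \<Rightarrow> ('a \<Rightarrow> ereal) \<Rightarrow> bool" where
  "kantorovich_potentials p \<rho> \<mu> \<phi> \<psi> \<longleftrightarrow> admissible_pair p \<rho> \<mu> \<phi> \<psi> \<and>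
     (\<forall>\<phi>' \<psi>'. admissible_pair p \<rho> \<mu> \<phi>' \<psi>' \<longrightarrow>
        ereal_integral \<rho> \<phi>' + ereal_integral \<mu> \<psi>' \<le> ereal_integral \<rho> \<phi> + ereal_integral \<mu> \<psi>)"

definition square_integrable :: "'a measure \<Rightarrow> ('a \<Rightarrow> real) \<Rightarrow> bool" where
  "square_integrable M f \<longleftrightarrow> f \<in> borel_measurable M \<and> integrable M (\<lambda>x. (f x)\<^sup>2)"

definition L2_norm :: "'a measure \<Rightarrow> ('a \<Rightarrow> real) \<Rightarrow> real" where
  "L2_norm M f = sqrt (\<integral>x. (f x)\<^sup>2 \<partial>M)"

end

theory Submission
  imports Defs
begin

text \<open>
  Proof idea. Replace both pairs of potentials by \<open>c\<close>-transforms \<open>(f\<^sub>0, g\<^sub>0)\<close>, \<open>(f\<^sub>1, g\<^sub>1)\<close>, which are Lipschitz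
  on a ball \<open>X\<close>, and let \<open>f\<close> be the \<open>c\<close>-transform of \<open>(g\<^sub>0 + g\<^sub>1) / 2\<close>. Testing the two dual problems with
  \<open>(f, (g\<^sub>0 + g\<^sub>1) / 2)\<close> bounds the integral of the midpoint gap \<open>D = 2 f - f\<^sub>0 - f\<^sub>1 \<ge> 0\<close> by \<open>L W\<^sub>1(\<mu>, \<nu>)\<close>.
  Conversely the gap controls the variance of \<open>f\<^sub>0 - f\<^sub>1\<close>. With \<open>q = min p 2\<close>, the cost is semiconcave up
  to an error \<open>|x - x'|\<^sup>q \<le> \<epsilon>\<^sup>q\<^sup>-\<^sup>2 |x - x'|\<^sup>2 + \<epsilon>\<^sup>q\<close>; multiplying by \<open>\<epsilon>\<^sup>2\<^sup>-\<^sup>q\<close> and subtracting a fixed multiple of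
  \<open>|x|\<^sup>2\<close> turns \<open>f\<^sub>0, f\<^sub>1, f\<close> into functions to which Prekopa-Leindler applies with an error of order \<open>\<epsilon>\<^sup>2\<close>.
  Expanding the exponentials to second order in this midpoint inequality gives a Brascamp-Lieb type
  bound of the variance by \<open>\<epsilon>\<^sup>q\<^sup>-\<^sup>2 \<integral>D + \<epsilon>\<^sup>2\<^sup>q\<^sup>-\<^sup>2\<close>, and \<open>\<epsilon>\<^sup>q = W\<^sub>1(\<mu>, \<nu>)\<close> yields the exponent \<open>1 - 1/q\<close>.
\<close>

section \<open>The Prekopa-Leindler inequality\<close>

text \<open>On the diagonal \<open>x = x'\<close> one only learns \<open>D \<ge> 0\<close>: the
  transform is an infimum of affine maps of \<open>g\<close>, hence concave. The information on
  \<open>f\<^sub>0 - f\<^sub>1\<close> sits in the two-point inequality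
  \<open>f\<^sub>0 x + f\<^sub>1 x' \<le> 2 f ((x + x') / 2) + error\<close>, which couples
  different functions at different points and has exactly the shape of the Prekopa-Leindler
  hypothesis. A quadratic error is paid for by \<open>|x|^2\<close> through the parallelogram
  identity, a constant error by a constant factor. The obstacle is \<open>p < 2\<close>: the cost is
  not semiconcave at the origin, and its quadratic constant at scale \<open>\<epsilon>\<close> grows
  like \<open>\<epsilon> powr (q - 2)\<close>. Without the factor
  \<open>\<epsilon> powr (2 - q)\<close> the bounds on the exponentials would degenerate as
  \<open>\<epsilon>\<close> tends to 0. Undoing the scaling leaves
  \<open>\<epsilon> powr (q - 2)\<close> in front of the gap and
  \<open>\<epsilon> powr (2 * q - 2)\<close> as error; for a gap of order \<open>W\<close> the two
  balance at \<open>\<epsilon> powr q = W\<close>. The squared norm is then of order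
  \<open>W powr (2 - 2 / q)\<close>.\<close>

text \<open>\<open>A\<close> need not contain its supremum or be bounded. Cutting at points of
  \<open>A\<close> replaces the usual reduction to compact sets, where one cuts at the maximum; only
  a maximum of \<open>A\<close> escapes all cuts, and a single point is a null set.\<close>

lemma emeasure_le_SUP_cut:
  fixes A :: "real set"
  assumes [measurable]: "A \<in> sets borel" and ne: "A \<noteq> {}"
  shows "emeasure lborel A \<le> (SUP a\<in>A. emeasure lborel (A \<inter> {..<a}))"
proof -
  obtain D where D: "countable D" "D \<subseteq> A" "A \<subseteq> closure D"
    using separable[of A] by blast
  have Dne: "D \<noteq> {}" using D ne by auto
  \<comment> \<open>Running maxima of an enumeration of the dense set \<open>D\<close>: an
    increasing sequence inside \<open>A\<close> that eventually exceeds every non-maximal point of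
    \<open>A\<close>.\<close>
  define a where "a n = Max (from_nat_into D ` {..n})" for n :: nat
  have aA: "a n \<in> A" for n
  proof -
    have "a n \<in> from_nat_into D ` {..n}" unfolding a_def by (rule Max_in) auto
    then show ?thesis using D(2) from_nat_into[OF Dne] by auto
  qed
  have amono: "incseq a"
    unfolding a_def by (intro monoI Max_mono) auto
  define m where "m = {x\<in>A. \<forall>y\<in>A. y \<le> x}"
  have m1: "m \<subseteq> {Sup A}"
  proof
    fix x assume "x \<in> m"
    then have "Sup A = x" unfolding m_def by (intro cSup_eq_maximum) auto
    then show "x \<in> {Sup A}" by simp
  qed
  have "A \<subseteq> (\<Union>n. A \<inter> {..<a n}) \<union> {Sup A}"
  proof
    fix x assume x: "x \<in> A"
    show "x \<in> (\<Union>n. A \<inter> {..<a n}) \<union> {Sup A}"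
    proof (cases "x \<in> m")
      case False
      then obtain y where y: "y \<in> A" "x < y" unfolding m_def using x by force
      then have "{x<..} \<inter> D \<noteq> {}" 
        using D(3) open_Int_closure_eq_empty[of "{x<..}" D] by auto
      then obtain d where d: "d \<in> D" "x < d" by auto
      then obtain n where "d = from_nat_into D n"
        using D(1) by (metis from_nat_into_surj)
      then have "d \<le> a n" unfolding a_def by (intro Max_ge) auto
      with d(2) have "x < a n" by simp
      then show ?thesis using x by blast
    qed (use m1 in auto)
  qed
  then have "emeasure lborel A \<le> emeasure lborel ((\<Union>n. A \<inter> {..<a n}) \<union> {Sup A})"
    by (intro emeasure_mono) auto
  also have "\<dots> \<le> emeasure lborel (\<Union>n. A \<inter> {..<a n}) + emeasure lborel {Sup A}"
    by (intro emeasure_subadditive) auto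
  also have "\<dots> = emeasure lborel (\<Union>n. A \<inter> {..<a n})" by simp
  also have "\<dots> = (SUP n. emeasure lborel (A \<inter> {..<a n}))"
    using amono by (intro SUP_emeasure_incseq[symmetric]) (auto simp: incseq_def intro: less_le_trans)
  also have "\<dots> \<le> (SUP a\<in>A. emeasure lborel (A \<inter> {..<a}))"
    using aA by (intro SUP_least SUP_upper2[OF aA]) auto
  finally show ?thesis .
qed

lemma emeasure_le_SUP_cut':
  fixes B :: "real set"
  assumes [measurable]: "B \<in> sets borel" and ne: "B \<noteq> {}"
  shows "emeasure lborel B \<le> (SUP b\<in>B. emeasure lborel (B \<inter> {b<..}))"
proof -
  have refl: "emeasure lborel (uminus -` C) = emeasure lborel C" if "C \<in> sets borel" for C :: "real set"
    using that by (subst (2) lborel_distr_uminus[symmetric]) (simp add: emeasure_distr)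
  have [measurable]: "uminus -` B \<in> sets borel"
    using measurable_sets_borel[of uminus borel B] by simp
  have "emeasure lborel B = emeasure lborel (uminus -` B)" by (simp add: refl)
  also have "\<dots> \<le> (SUP a\<in>uminus -` B. emeasure lborel (uminus -` B \<inter> {..<a}))"
  proof (rule emeasure_le_SUP_cut)
    obtain b where "b \<in> B" using ne by auto
    then have "- b \<in> uminus -` B" by simp
    then show "uminus -` B \<noteq> {}" by blast
  qed simp
  also have "\<dots> \<le> (SUP b\<in>B. emeasure lborel (B \<inter> {b<..}))"
  proof (rule SUP_least)
    fix a assume "a \<in> uminus -` B"
    have "emeasure lborel (uminus -` B \<inter> {..<a}) = emeasure lborel (uminus -` (B \<inter> {-a<..}))"
      by (intro arg_cong[where f="emeasure lborel"]) auto
    also have "\<dots> = emeasure lborel (B \<inter> {-a<..})" by (intro refl) auto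
    finally show "emeasure lborel (uminus -` B \<inter> {..<a}) \<le> (SUP b\<in>B. emeasure lborel (B \<inter> {b<..}))"
      using \<open>a \<in> uminus -` B\<close> by (auto intro: SUP_upper)
  qed
  finally show ?thesis .
qed

text \<open>\<open>C\<close> is any measurable set containing the midpoints, since the midpoint set
  itself may fail to be measurable. Nonemptiness is essential: with \<open>B\<close> empty the
  condition on \<open>C\<close> is void.\<close>

lemma brunn_minkowski_midpoint_real:
  fixes A B C :: "real set"
  assumes [measurable]: "A \<in> sets borel" "B \<in> sets borel" "C \<in> sets borel"
    and ne: "A \<noteq> {}" "B \<noteq> {}"
    and mid: "\<And>x y. x \<in> A \<Longrightarrow> y \<in> B \<Longrightarrow> (x + y) / 2 \<in> C"
  shows "emeasure lborel A + emeasure lborel B \<le> 2 * emeasure lborel C"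
proof -
  \<comment> \<open>The integrand is the indicator of \<open>(S + t) / 2\<close>.\<close>
  have halve: "emeasure lborel S = 2 * (\<integral>\<^sup>+z. indicator S (2 * z - t) \<partial>lborel)"
    if "S \<in> sets borel" for S and t :: real
    using nn_integral_real_affine[of "indicator S" 2 "- t"] that by (simp add: algebra_simps)
  \<comment> \<open>The midpoint sets of \<open>A \<inter> {..<a}\<close> with \<open>b\<close> and of \<open>a\<close> with \<open>B \<inter> {b<..}\<close> lie on different sides of \<open>(a + b) / 2\<close>.\<close>
  have cut: "emeasure lborel (A \<inter> {..<a}) + emeasure lborel (B \<inter> {b<..}) \<le> 2 * emeasure lborel C"
    if "a \<in> A" "b \<in> B" for a b
  proof -
    have "emeasure lborel (A \<inter> {..<a}) + emeasure lborel (B \<inter> {b<..})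
      = 2 * ((\<integral>\<^sup>+z. indicator (A \<inter> {..<a}) (2 * z - b) \<partial>lborel) +
             (\<integral>\<^sup>+z. indicator (B \<inter> {b<..}) (2 * z - a) \<partial>lborel))"
      using halve[of "A \<inter> {..<a}" b] halve[of "B \<inter> {b<..}" a] by (simp add: distrib_left)
    also have "\<dots> = 2 * (\<integral>\<^sup>+z. indicator (A \<inter> {..<a}) (2 * z - b) + indicator (B \<inter> {b<..}) (2 * z - a) \<partial>lborel)"
      by (subst nn_integral_add) auto
    also have "\<dots> \<le> 2 * (\<integral>\<^sup>+z. indicator C z \<partial>lborel)"
    proof (intro mult_left_mono nn_integral_mono)
      fix z :: real
      show "indicator (A \<inter> {..<a}) (2 * z - b) + indicator (B \<inter> {b<..}) (2 * z - a) \<le> (indicator C z :: ennreal)"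
        using mid[of "2 * z - b" b] mid[of a "2 * z - a"] that by (auto simp: indicator_def)
    qed simp
    finally show ?thesis by simp
  qed
  have "emeasure lborel A + emeasure lborel B
      \<le> (SUP a\<in>A. emeasure lborel (A \<inter> {..<a})) + (SUP b\<in>B. emeasure lborel (B \<inter> {b<..}))"
    using ne by (intro add_mono emeasure_le_SUP_cut emeasure_le_SUP_cut') auto
  also have "\<dots> = (SUP b\<in>B. SUP a\<in>A. emeasure lborel (A \<inter> {..<a}) + emeasure lborel (B \<inter> {b<..}))"
    using ne by (simp add: ennreal_SUP_add_left[symmetric] ennreal_SUP_add_right)
  also have "\<dots> \<le> 2 * emeasure lborel C"
    by (intro SUP_least cut)
  finally show ?thesis .
qed

section \<open>From level sets to functions, on the line and then in several dimensions\<close>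

text \<open>The factor \<open>r\<close> rescales the levels, so that superlevel sets of functions
  with different suprema can be compared at the same parameter \<open>t\<close>.\<close>

lemma nn_integral_layer_cake:
  fixes f :: "'a \<Rightarrow> ennreal" and r :: real
  assumes "sigma_finite_measure M" and [measurable]: "f \<in> borel_measurable M" and r: "r > 0"
  shows "(\<integral>\<^sup>+x. f x \<partial>M) = ennreal r * (\<integral>\<^sup>+t. indicator {0..} t * emeasure M {x\<in>space M. ennreal (r * t) < f x} \<partial>lborel)"
proof -
  interpret M: sigma_finite_measure M by fact
  interpret P: pair_sigma_finite M "lborel :: real measure" by standard
  have "f x = ennreal r * (\<integral>\<^sup>+t. indicator {0..} t * indicator {t. ennreal (r * t) < f x} t \<partial>lborel)" for x
  proof (cases "f x")
    case (real s)
    have "(\<integral>\<^sup>+t. indicator {0..} t * indicator {t. ennreal (r * t) < f x} t \<partial>lborel)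
        = (\<integral>\<^sup>+t. indicator {0..<s/r} t \<partial>lborel)"
      using r real by (intro nn_integral_cong) (auto simp: indicator_def ennreal_less_iff field_simps)
    also have "\<dots> = ennreal (s / r)" using r real by simp
    finally show ?thesis using r real by (simp add: ennreal_mult'[symmetric])
  next
    case top
    have "(\<integral>\<^sup>+t. indicator {0..} t * indicator {t. ennreal (r * t) < f x} t \<partial>lborel)
        = (\<integral>\<^sup>+t. indicator {0::real..} t \<partial>lborel)"
      using top by (intro nn_integral_cong) (auto simp: indicator_def)
    also have "\<dots> = emeasure lborel {0::real..}" by (rule nn_integral_indicator) simp
    also have "\<dots> = top"
    proof -
      have "of_nat n \<le> emeasure lborel {0::real..}" for n
        using emeasure_mono[of "{0..real n}" "{0..}" lborel] by (auto simp: ennreal_of_nat_eq_real_of_nat)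
      then show ?thesis
        by (metis SUP_least ennreal_SUP_of_nat_eq_top top.extremum_uniqueI)
    qed
    finally show ?thesis using r top by (simp add: ennreal_mult_top)
  qed
  then have "(\<integral>\<^sup>+x. f x \<partial>M) = (\<integral>\<^sup>+x. ennreal r * (\<integral>\<^sup>+t. indicator {0..} t * indicator {t. ennreal (r * t) < f x} t \<partial>lborel) \<partial>M)"
    by (intro nn_integral_cong)
  also have "\<dots> = ennreal r * (\<integral>\<^sup>+x. (\<integral>\<^sup>+t. indicator {0..} t * indicator {t. ennreal (r * t) < f x} t \<partial>lborel) \<partial>M)"
    by (intro nn_integral_cmult) measurable
  also have "(\<integral>\<^sup>+x. (\<integral>\<^sup>+t. indicator {0..} t * indicator {t. ennreal (r * t) < f x} t \<partial>lborel) \<partial>M)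
      = (\<integral>\<^sup>+t. (\<integral>\<^sup>+x. indicator {0..} t * indicator {t. ennreal (r * t) < f x} t \<partial>M) \<partial>lborel)"
    by (intro P.Fubini'[symmetric]) measurable
  also have "\<dots> = (\<integral>\<^sup>+t. indicator {0..} t * emeasure M {x\<in>space M. ennreal (r * t) < f x} \<partial>lborel)"
  proof (intro nn_integral_cong)
    fix t :: real
    have "(\<integral>\<^sup>+x. indicator {0..} t * indicator {t. ennreal (r * t) < f x} t \<partial>M)
       = (\<integral>\<^sup>+x. indicator {0..} t * indicator {x\<in>space M. ennreal (r * t) < f x} x \<partial>M)"
      by (intro nn_integral_cong) (auto simp: indicator_def)
    also have "\<dots> = indicator {0..} t * emeasure M {x\<in>space M. ennreal (r * t) < f x}"
      by (subst nn_integral_cmult_indicator) auto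
    finally show "(\<integral>\<^sup>+x. indicator {0..} t * indicator {t. ennreal (r * t) < f x} t \<partial>M)
      = indicator {0..} t * emeasure M {x\<in>space M. ennreal (r * t) < f x}" .
  qed
  finally show ?thesis .
qed


lemma ennreal_four_mult_le_square_add: "4 * (a * b) \<le> (a + b)\<^sup>2" for a b :: ennreal
proof (cases a; cases b)
  fix r s :: real assume "0 \<le> r" "a = ennreal r" "0 \<le> s" "b = ennreal s"
  moreover have "4 * (r * s) \<le> (r + s)\<^sup>2"
    using zero_le_power2[of "r - s"] by (simp add: power2_eq_square algebra_simps)
  ultimately show ?thesis
    by (simp add: ennreal_mult'[symmetric] ennreal_plus[symmetric] ennreal_power ennreal_leI
        flip: ennreal_numeral del: ennreal_plus)
qed (auto simp: power2_eq_square ennreal_mult_top ennreal_top_mult)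

text \<open>Measured relative to the finite suprema \<open>a\<close> and \<open>b\<close>, the
  superlevel sets of \<open>f\<close> and \<open>g\<close> are both nonempty for
  \<open>0 \<le> t < 1\<close> and both empty for \<open>t \<ge> 1\<close>, as one-dimensional
  Brunn-Minkowski needs. Integrating over \<open>t\<close> gives an additive inequality, and the
  arithmetic-geometric mean inequality turns it into the product form.\<close>

lemma prekopa_leindler_real_bounded:
  fixes f g h :: "real \<Rightarrow> ennreal"
  assumes [measurable]: "f \<in> borel_measurable borel" "g \<in> borel_measurable borel" "h \<in> borel_measurable borel"
    and bdd: "\<And>x. f x \<le> ennreal B" "\<And>x. g x \<le> ennreal B"
    and mid: "\<And>x y. f x * g y \<le> (h ((x + y) / 2))\<^sup>2"
  shows "(\<integral>\<^sup>+x. f x \<partial>lborel) * (\<integral>\<^sup>+x. g x \<partial>lborel) \<le> (\<integral>\<^sup>+x. h x \<partial>lborel)\<^sup>2"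
proof -
  have *: "\<exists>a. (SUP x. f x) = ennreal a" if "\<And>x. f x \<le> ennreal B" for f :: "real \<Rightarrow> ennreal"
  proof -
    have "(SUP x. f x) \<le> ennreal B" using that by (intro SUP_least)
    also have "ennreal B < top" by simp
    finally show ?thesis by (metis ennreal_enn2real)
  qed
  obtain a b where ab: "(SUP x. f x) = ennreal a" "(SUP x. g x) = ennreal b"
    using *[of f, OF bdd(1)] *[of g, OF bdd(2)] by blast
  show ?thesis
  proof (cases "a > 0 \<and> b > 0")
    case False
    then have "(SUP x. f x) = 0 \<or> (SUP x. g x) = 0" using ab by (auto simp: ennreal_neg)
    then have "(\<forall>x. f x = 0) \<or> (\<forall>x. g x = 0)"
      by (metis SUP_upper UNIV_I le_zero_eq)
    then show ?thesis by (elim disjE) simp_all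
  next
    case True
    \<comment> \<open>The matching level for \<open>h\<close>, because
      \<open>(a * t) * (b * t) = (s * t)\<^sup>2\<close>.\<close>
    define s where "s = sqrt (a * b)"
    have s: "s > 0" "s\<^sup>2 = a * b" using True by (auto simp: s_def)
    let ?If = "\<integral>\<^sup>+t. indicator {0..} t * emeasure lborel {x\<in>space lborel. ennreal (a * t) < f x} \<partial>lborel"
    let ?Ig = "\<integral>\<^sup>+t. indicator {0..} t * emeasure lborel {x\<in>space lborel. ennreal (b * t) < g x} \<partial>lborel"
    let ?Ih = "\<integral>\<^sup>+t. indicator {0..} t * emeasure lborel {x\<in>space lborel. ennreal (s * t) < h x} \<partial>lborel"
    have I: "(\<integral>\<^sup>+x. f x \<partial>lborel) = ennreal a * ?If" "(\<integral>\<^sup>+x. g x \<partial>lborel) = ennreal b * ?Ig"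
        "(\<integral>\<^sup>+x. h x \<partial>lborel) = ennreal s * ?Ih"
      using True s by (intro nn_integral_layer_cake; simp add: lborel.sigma_finite_measure_axioms)+
    have "?If + ?Ig = (\<integral>\<^sup>+t. indicator {0..} t * emeasure lborel {x\<in>space lborel. ennreal (a * t) < f x} +
        indicator {0..} t * emeasure lborel {x\<in>space lborel. ennreal (b * t) < g x} \<partial>lborel)"
      by (intro nn_integral_add[symmetric]) measurable
    also have "\<dots> \<le> (\<integral>\<^sup>+t. 2 * (indicator {0..} t * emeasure lborel {x\<in>space lborel. ennreal (s * t) < h x}) \<partial>lborel)"
    proof (rule nn_integral_mono)
      fix t :: real
      let ?A = "{x\<in>space lborel. ennreal (a * t) < f x}"
      let ?B = "{x\<in>space lborel. ennreal (b * t) < g x}"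
      let ?C = "{x\<in>space lborel. ennreal (s * t) < h x}"
      have "emeasure lborel ?A + emeasure lborel ?B \<le> 2 * emeasure lborel ?C" if "t \<ge> 0"
      proof (cases "t < 1")
        case True
        have a1: "ennreal (a * t) < ennreal a" "ennreal (b * t) < ennreal b"
          using \<open>a > 0 \<and> b > 0\<close> True that by (auto simp: ennreal_less_iff)
        have ne: "?A \<noteq> {}" "?B \<noteq> {}"
          using a1 unfolding ab[symmetric] less_SUP_iff by auto
        have "(x + y) / 2 \<in> ?C" if "x \<in> ?A" "y \<in> ?B" for x y
        proof -
          have lt: "ennreal (a * t) < f x" "ennreal (b * t) < g y" using that by auto
          obtain u v where uv: "f x = ennreal u" "g y = ennreal v" "u \<ge> 0" "v \<ge> 0"
            using bdd by (metis ennreal_cases ennreal_neq_top neq_top_trans)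
          have "a * t < u" "b * t < v" using lt uv \<open>a > 0 \<and> b > 0\<close> \<open>t \<ge> 0\<close> by (auto simp: ennreal_less_iff)
          then have "(a * t) * (b * t) < u * v"
            using \<open>a > 0 \<and> b > 0\<close> \<open>t \<ge> 0\<close> by (intro mult_strict_mono') auto
          moreover have "(s * t)\<^sup>2 = (a * t) * (b * t)"
            unfolding power_mult_distrib s(2) by (simp add: power2_eq_square)
          ultimately have "(s * t)\<^sup>2 < u * v" by simp
          then have "ennreal ((s * t)\<^sup>2) < ennreal (u * v)" by (simp add: ennreal_less_iff)
          also have "\<dots> \<le> (h ((x + y) / 2))\<^sup>2" using mid[of x y] uv by (simp add: ennreal_mult)
          finally have *: "(ennreal (s * t))\<^sup>2 < (h ((x + y) / 2))\<^sup>2"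
            using s \<open>t \<ge> 0\<close> by (simp add: ennreal_power)
          have "\<not> h ((x + y) / 2) \<le> ennreal (s * t)"
            using * power_mono[of "h ((x + y) / 2)" "ennreal (s * t)" 2] by (auto simp: not_le[symmetric])
          then show ?thesis by (simp add: not_le)
        qed
        then show ?thesis using ne by (intro brunn_minkowski_midpoint_real) auto
      next
        case False
        have "f x \<le> ennreal a" "g x \<le> ennreal b" for x unfolding ab[symmetric] by (auto intro: SUP_upper)
        moreover have "ennreal a \<le> ennreal (a * t)" "ennreal b \<le> ennreal (b * t)"
          using False \<open>a > 0 \<and> b > 0\<close> by (auto intro!: ennreal_leI)
        ultimately have "?A = {}" "?B = {}" by (auto simp: not_less intro: order_trans)
        then show ?thesis by simp
      qed
      then show "indicator {0..} t * emeasure lborel ?A + indicator {0..} t * emeasure lborel ?B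
          \<le> 2 * (indicator {0..} t * emeasure lborel ?C)"
        by (auto simp: indicator_def)
    qed
    also have "\<dots> = 2 * ?Ih" by (intro nn_integral_cmult) measurable
    finally have le: "?If + ?Ig \<le> 2 * ?Ih" .
    have "4 * (?If * ?Ig) \<le> (?If + ?Ig)\<^sup>2" by (rule ennreal_four_mult_le_square_add)
    also have "\<dots> \<le> (2 * ?Ih)\<^sup>2" using le by (rule power_mono) simp
    finally have "4 * (?If * ?Ig) \<le> 4 * ?Ih\<^sup>2" by (simp add: power_mult_distrib)
    then have le4: "?If * ?Ig \<le> ?Ih\<^sup>2" by (subst (asm) ennreal_mult_le_mult_iff) auto
    have "(\<integral>\<^sup>+x. f x \<partial>lborel) * (\<integral>\<^sup>+x. g x \<partial>lborel) = (ennreal a * ennreal b) * (?If * ?Ig)"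
      unfolding I by (simp add: ac_simps)
    also have "\<dots> \<le> (ennreal a * ennreal b) * ?Ih\<^sup>2" using le4 by (intro mult_left_mono) auto
    also have "ennreal a * ennreal b = (ennreal s)\<^sup>2" using True s by (simp add: ennreal_power ennreal_mult'[symmetric])
    also have "(ennreal s)\<^sup>2 * ?Ih\<^sup>2 = (\<integral>\<^sup>+x. h x \<partial>lborel)\<^sup>2" unfolding I by (simp add: power_mult_distrib)
    finally show ?thesis .
  qed
qed

lemma nn_integral_min_SUP:
  assumes [measurable]: "f \<in> borel_measurable M"
  shows "(\<integral>\<^sup>+x. f x \<partial>M) = (SUP n. \<integral>\<^sup>+x. min (f x) (of_nat n) \<partial>M)"
proof -
  have "(SUP n. \<integral>\<^sup>+x. min (f x) (of_nat n) \<partial>M) = (\<integral>\<^sup>+x. (SUP n. min (f x) (of_nat n)) \<partial>M)"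
    by (rule nn_integral_monotone_convergence_SUP[symmetric])
       (auto simp: incseq_def le_fun_def intro!: min.coboundedI2 of_nat_mono)
  also have "\<dots> = (\<integral>\<^sup>+x. f x \<partial>M)"
    by (intro nn_integral_cong) (simp add: inf_min[symmetric] inf_SUP[symmetric] ennreal_SUP_of_nat_eq_top)
  finally show ?thesis ..
qed

lemma prekopa_leindler_real:
  fixes f g h :: "real \<Rightarrow> ennreal"
  assumes [measurable]: "f \<in> borel_measurable borel" "g \<in> borel_measurable borel" "h \<in> borel_measurable borel"
    and mid: "\<And>x y. f x * g y \<le> (h ((x + y) / 2))\<^sup>2"
  shows "(\<integral>\<^sup>+x. f x \<partial>lborel) * (\<integral>\<^sup>+x. g x \<partial>lborel) \<le> (\<integral>\<^sup>+x. h x \<partial>lborel)\<^sup>2"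
proof -
  have "(\<integral>\<^sup>+x. min (f x) (of_nat m) \<partial>lborel) * (\<integral>\<^sup>+x. min (g x) (of_nat n) \<partial>lborel)
      \<le> (\<integral>\<^sup>+x. h x \<partial>lborel)\<^sup>2" for m n
  proof (rule prekopa_leindler_real_bounded[where B="real (max m n)"])
    fix x y :: real
    show "min (f x) (of_nat m) \<le> ennreal (real (max m n))" "min (g x) (of_nat n) \<le> ennreal (real (max m n))"
      by (auto simp: ennreal_of_nat_eq_real_of_nat intro!: min.coboundedI2 ennreal_leI)
    have "min (f x) (of_nat m) * min (g y) (of_nat n) \<le> f x * g y" by (intro mult_mono) auto
    also note mid
    finally show "min (f x) (of_nat m) * min (g y) (of_nat n) \<le> (h ((x + y) / 2))\<^sup>2" .
  qed auto
  then show ?thesis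
    by (subst (1 2) nn_integral_min_SUP)
       (auto simp: SUP_mult_left_ennreal SUP_mult_right_ennreal intro!: SUP_least)
qed

text \<open>Tensorisation: fix the new coordinate to \<open>y1\<close>, \<open>y2\<close> and their
  midpoint. The induction hypothesis for these slices is precisely the hypothesis of the
  one-dimensional inequality for the slice integrals.\<close>

lemma prekopa_leindler_PiM:
  fixes f g h :: "('i \<Rightarrow> real) \<Rightarrow> ennreal"
  assumes "finite I"
    and "f \<in> borel_measurable (\<Pi>\<^sub>M i\<in>I. lborel)" "g \<in> borel_measurable (\<Pi>\<^sub>M i\<in>I. lborel)"
      "h \<in> borel_measurable (\<Pi>\<^sub>M i\<in>I. lborel)"
    and "\<And>x y. x \<in> extensional I \<Longrightarrow> y \<in> extensional I \<Longrightarrow> f x * g y \<le> (h (\<lambda>i\<in>I. (x i + y i) / 2))\<^sup>2"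
  shows "(\<integral>\<^sup>+x. f x \<partial>(\<Pi>\<^sub>M i\<in>I. lborel)) * (\<integral>\<^sup>+x. g x \<partial>(\<Pi>\<^sub>M i\<in>I. lborel))
    \<le> (\<integral>\<^sup>+x. h x \<partial>(\<Pi>\<^sub>M i\<in>I. lborel))\<^sup>2"
  using assms
proof (induction I arbitrary: f g h rule: finite_induct)
  case empty
  interpret product_sigma_finite "\<lambda>_::'i. lborel :: real measure" by standard
  show ?case using empty.prems(4)[of "\<lambda>_. undefined" "\<lambda>_. undefined"]
    by (simp add: PiM_empty nn_integral_count_space_finite restrict_def)
next
  case (insert i I)
  interpret product_sigma_finite "\<lambda>_::'i. lborel :: real measure" by standard
  interpret fin: finite_product_sigma_finite "\<lambda>_::'i. lborel :: real measure" I
    by standard (fact insert.hyps)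
  have meas: "(\<lambda>(y, x). k (x(i := y))) \<in> borel_measurable (lborel \<Otimes>\<^sub>M (\<Pi>\<^sub>M i\<in>I. lborel))"
    if [measurable]: "k \<in> borel_measurable (\<Pi>\<^sub>M i\<in>insert i I. lborel)" for k :: "('i \<Rightarrow> real) \<Rightarrow> ennreal"
    by measurable
  have slice: "(\<lambda>x. k (x(i := y))) \<in> borel_measurable (\<Pi>\<^sub>M i\<in>I. lborel)"
    if "k \<in> borel_measurable (\<Pi>\<^sub>M i\<in>insert i I. lborel)" for k :: "('i \<Rightarrow> real) \<Rightarrow> ennreal" and y
    using measurable_compose[OF measurable_Pair1' meas[OF that], of y] by simp
  have outer: "(\<lambda>y. \<integral>\<^sup>+x. k (x(i := y)) \<partial>(\<Pi>\<^sub>M i\<in>I. lborel)) \<in> borel_measurable borel"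
    if "k \<in> borel_measurable (\<Pi>\<^sub>M i\<in>insert i I. lborel)" for k :: "('i \<Rightarrow> real) \<Rightarrow> ennreal"
    using fin.borel_measurable_nn_integral[OF meas[OF that]] by simp
  note ms = insert.prems(1-3)
  show ?case
    unfolding product_nn_integral_insert_rev[OF insert.hyps ms(1)]
      product_nn_integral_insert_rev[OF insert.hyps ms(2)] product_nn_integral_insert_rev[OF insert.hyps ms(3)]
  proof (rule prekopa_leindler_real)
    fix y1 y2 :: real
    show "(\<integral>\<^sup>+x. f (x(i := y1)) \<partial>(\<Pi>\<^sub>M i\<in>I. lborel)) * (\<integral>\<^sup>+x. g (x(i := y2)) \<partial>(\<Pi>\<^sub>M i\<in>I. lborel))
      \<le> (\<integral>\<^sup>+x. h (x(i := (y1 + y2) / 2)) \<partial>(\<Pi>\<^sub>M i\<in>I. lborel))\<^sup>2"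
    proof (rule insert.IH)
      fix x1 x2 :: "'i \<Rightarrow> real" assume x: "x1 \<in> extensional I" "x2 \<in> extensional I"
      have "(\<lambda>j\<in>insert i I. ((x1(i := y1)) j + (x2(i := y2)) j) / 2)
         = (\<lambda>j\<in>I. (x1 j + x2 j) / 2)(i := (y1 + y2) / 2)"
        using insert.hyps by (auto simp: restrict_def fun_eq_iff)
      moreover have "x1(i := y1) \<in> extensional (insert i I)" "x2(i := y2) \<in> extensional (insert i I)"
        using x by (auto simp: extensional_def)
      ultimately show "f (x1(i := y1)) * g (x2(i := y2)) \<le> (h ((\<lambda>j\<in>I. (x1 j + x2 j) / 2)(i := (y1 + y2) / 2)))\<^sup>2"
        using insert.prems(4) by metis
    qed (intro slice ms)+
  qed (intro outer ms)+
qed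

theorem prekopa_leindler_midpoint:
  fixes f g h :: "'a::euclidean_space \<Rightarrow> ennreal"
  assumes [measurable]: "f \<in> borel_measurable borel" "g \<in> borel_measurable borel" "h \<in> borel_measurable borel"
    and mid: "\<And>x y. f x * g y \<le> (h ((1/2) *\<^sub>R (x + y)))\<^sup>2"
  shows "(\<integral>\<^sup>+x. f x \<partial>lborel) * (\<integral>\<^sup>+x. g x \<partial>lborel) \<le> (\<integral>\<^sup>+x. h x \<partial>lborel)\<^sup>2"
proof -
  let ?e = "\<lambda>z. \<Sum>b\<in>Basis. z b *\<^sub>R b :: 'a"
  have [measurable]: "?e \<in> (\<Pi>\<^sub>M b\<in>Basis. lborel) \<rightarrow>\<^sub>M borel" by measurable
  have "(\<integral>\<^sup>+z. f (?e z) \<partial>(\<Pi>\<^sub>M b\<in>Basis. lborel)) * (\<integral>\<^sup>+z. g (?e z) \<partial>(\<Pi>\<^sub>M b\<in>Basis. lborel))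
    \<le> (\<integral>\<^sup>+z. h (?e z) \<partial>(\<Pi>\<^sub>M b\<in>Basis. lborel))\<^sup>2"
  proof (rule prekopa_leindler_PiM)
    fix x y :: "'a \<Rightarrow> real"
    have "?e (\<lambda>b\<in>Basis. (x b + y b) / 2) = (1/2) *\<^sub>R (?e x + ?e y)"
      by (simp add: scaleR_sum_right sum.distrib[symmetric] scaleR_add_left[symmetric])
    then show "f (?e x) * g (?e y) \<le> (h (?e (\<lambda>b\<in>Basis. (x b + y b) / 2)))\<^sup>2"
      using mid by simp
  qed measurable
  then show ?thesis
    by (subst (1 2 3) lborel_eq) (simp add: nn_integral_distr)
qed

section \<open>Midpoint estimates for the power cost\<close>

text \<open>Weighted arithmetic-geometric mean for \<open>1 + x\<close> and \<open>1\<close> with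
  weights \<open>r\<close> and \<open>1 - r\<close>; it asks for positive numbers, so
  \<open>x = -1\<close> is separate.\<close>

lemma powr_le_tangent:
  fixes x r :: real
  assumes "-1 \<le> x" "0 \<le> r" "r \<le> 1"
  shows "(1 + x) powr r \<le> 1 + r * x"
proof (cases "x = -1")
  case False
  then show ?thesis
    using Youngs_inequality_0[of r "1 - r" "1 + x" 1] assms by (simp add: algebra_simps)
qed (use assms in simp)

text \<open>The bound of \<open>powr_le_tangent\<close> with exponent \<open>1 / a\<close>, taken at
  the number \<open>(1 - x) powr a\<close> and solved for it.\<close>

lemma powr_ge_tangent:
  fixes x a :: real
  assumes "0 \<le> x" "x \<le> 1" "1 \<le> a"
  shows "1 - a * x \<le> (1 - x) powr a"
proof -
  have "((1 - x) powr a) powr (1 / a) \<le> 1 + (1 / a) * ((1 - x) powr a - 1)"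
    using powr_le_tangent[of "(1 - x) powr a - 1" "1 / a"] assms by simp
  moreover have "((1 - x) powr a) powr (1 / a) = 1 - x"
    using assms by (simp add: powr_powr)
  ultimately have "a * (1 - x) \<le> a * (1 + (1 / a) * ((1 - x) powr a - 1))"
    using assms by (intro mult_left_mono) auto
  then show ?thesis using assms by (simp add: algebra_simps)
qed

lemma power_le_tangent_plus_square:
  fixes y :: real
  assumes "-1 \<le> y" "y \<le> 1"
  shows "(1 + y) ^ n \<le> 1 + n * y + 3 ^ n * y\<^sup>2"
proof (induction n)
  case (Suc n)
  have n: "real n \<le> 3 ^ n" using of_nat_less_two_power[of n, where 'a=real] power_mono[of 2 "3::real" n] by simp
  have "(1 + y) ^ Suc n \<le> (1 + y) * (1 + n * y + 3 ^ n * y\<^sup>2)"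
    using Suc assms by (simp add: mult_left_mono)
  also have "\<dots> = 1 + Suc n * y + (real n + 3 ^ n + 3 ^ n * y) * y\<^sup>2"
    by (simp add: algebra_simps power2_eq_square)
  \<comment> \<open>One more factor 3 suffices because \<open>n \<le> 3 ^ n\<close> and
    \<open>y \<le> 1\<close>.\<close>
  also have "\<dots> \<le> 1 + Suc n * y + 3 ^ Suc n * y\<^sup>2"
  proof -
    have "3 ^ n * y \<le> 3 ^ n * 1" using assms by (intro mult_left_mono) auto
    then have "real n + 3 ^ n + 3 ^ n * y \<le> 3 ^ Suc n" unfolding power_Suc using n by linarith
    then show ?thesis by (intro add_left_mono mult_right_mono) auto
  qed
  finally show ?case .
qed simp

text \<open>A Taylor expansion fails near \<open>x = -1\<close>, where the second derivative blows
  up for \<open>1 < a < 2\<close>. Instead the power is written as an \<open>n\<close>-th power with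
  inner exponent \<open>a / n \<le> 1\<close>: Bernoulli's inequality inside, the integer case
  outside, valid up to the endpoint.\<close>

lemma powr_le_tangent_plus_square:
  fixes a x :: real
  assumes "0 \<le> a" "a \<le> real n" "0 < n" "\<bar>x\<bar> \<le> 1"
  shows "(1 + x) powr a \<le> 1 + a * x + 3 ^ n * x\<^sup>2"
proof (cases "x = -1")
  case True
  have "real n \<le> 3 ^ n" using of_nat_less_two_power[of n, where 'a=real] power_mono[of 2 "3::real" n] by simp
  then have "a \<le> 3 ^ n" using assms by linarith
  then show ?thesis using True by simp
next
  case False
  then have x: "1 + x > 0" "\<bar>x\<bar> \<le> 1" using assms by auto
  define y where "y = a / n * x"
  have r: "0 \<le> a / n" "a / n \<le> 1" using assms by auto
  have yx: "\<bar>y\<bar> \<le> \<bar>x\<bar>"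
    unfolding y_def abs_mult abs_of_nonneg[OF r(1)] using r by (intro mult_left_le_one_le) auto
  have y: "-1 \<le> y" "y \<le> 1" using yx x by auto
  have "(1 + x) powr a = ((1 + x) powr (a / n)) ^ n"
    using x assms by (simp add: powr_realpow[symmetric] powr_powr)
  also have "\<dots> \<le> (1 + y) ^ n"
    unfolding y_def using x r by (intro power_mono powr_le_tangent) auto
  also have "\<dots> \<le> 1 + n * y + 3 ^ n * y\<^sup>2" using y by (rule power_le_tangent_plus_square)
  also have "\<dots> \<le> 1 + a * x + 3 ^ n * x\<^sup>2"
    using yx assms by (auto simp: y_def[symmetric] abs_le_square_iff intro!: mult_left_mono) (simp add: y_def)
  finally show ?thesis .
qed

text \<open>After division by \<open>s + t\<close> both summands lie in the unit interval, where
  \<open>u \<le> u powr a\<close>.\<close>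

lemma powr_add_subadditive:
  fixes s t a :: real
  assumes "0 \<le> s" "0 \<le> t" "0 < a" "a \<le> 1"
  shows "(s + t) powr a \<le> s powr a + t powr a"
proof (cases "s + t = 0")
  case False
  then have st: "s + t > 0" using assms by auto
  have *: "u / (s + t) \<le> (u / (s + t)) powr a" if "0 \<le> u" "u \<le> s + t" for u
    using that st assms powr_mono'[of a 1 "u / (s + t)"] by simp
  have "1 = s / (s + t) + t / (s + t)" using st by (simp add: add_divide_distrib[symmetric])
  also have "\<dots> \<le> (s / (s + t)) powr a + (t / (s + t)) powr a"
    using assms by (intro add_mono *) auto
  also have "\<dots> = (s powr a + t powr a) / (s + t) powr a"
    using assms by (simp add: powr_divide add_divide_distrib)
  finally show ?thesis using st by (simp add: field_simps)
qed (use assms in auto)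

section \<open>Midpoint inequalities for powers of the norm\<close>

text \<open>The squared norms of \<open>m + w\<close> and \<open>m - w\<close> are
  \<open>A + B\<close> and \<open>A - B\<close> with \<open>A = |m|^2 + |w|^2\<close> and
  \<open>B = 2 * (m \<bullet> w)\<close>, so the midpoint estimates become statements about the real
  function \<open>s powr (p / 2)\<close>.\<close>

lemma norm_powr_via_square: "norm z powr p = ((norm z)\<^sup>2) powr (p / 2)" for z :: "'a::real_normed_vector"
proof -
  have "(norm z)\<^sup>2 = norm z powr 2" by simp
  then show ?thesis by (metis field_sum_of_halves mult_2 powr_powr times_divide_eq_right)
qed

text \<open>For \<open>p \<le> 2\<close> the function \<open>s powr (p / 2)\<close> is concave and
  subadditive: concavity removes the cross term \<open>B\<close>, subadditivity splits
  \<open>A\<close>.\<close>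

lemma norm_powr_midpoint_le_two:
  fixes m w :: "'a::real_inner"
  assumes "0 < p" "p \<le> 2"
  shows "norm (m + w) powr p + norm (m - w) powr p \<le> 2 * norm m powr p + 2 * norm w powr p"
proof -
  define A where "A = (norm m)\<^sup>2 + (norm w)\<^sup>2"
  define B where "B = 2 * (m \<bullet> w)"
  have sq: "(norm (m + w))\<^sup>2 = A + B" "(norm (m - w))\<^sup>2 = A - B"
    unfolding A_def B_def power2_norm_eq_inner by (simp_all add: inner_simps inner_commute)
  have nn: "A + B \<ge> 0" "A - B \<ge> 0" unfolding sq[symmetric] by simp_all
  have "norm (m + w) powr p + norm (m - w) powr p = (A + B) powr (p/2) + (A - B) powr (p/2)"
    by (subst (1 2) norm_powr_via_square) (simp add: sq)
  also have "\<dots> \<le> 2 * A powr (p/2)"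
  proof (cases "A = 0")
    case False
    then have A: "A > 0" using nn by auto
    define x where "x = B / A"
    have x: "-1 \<le> x" "-1 \<le> -x" using nn A by (auto simp: x_def field_simps)
    have e: "A + B = A * (1 + x)" "A - B = A * (1 + -x)" using A by (simp_all add: x_def field_simps)
    have "(A + B) powr (p/2) + (A - B) powr (p/2) = A powr (p/2) * ((1 + x) powr (p/2) + (1 + -x) powr (p/2))"
      unfolding e using A x by (subst (1 2) powr_mult) (auto simp: algebra_simps)
    also have "\<dots> \<le> A powr (p/2) * ((1 + p/2 * x) + (1 + p/2 * -x))"
      using assms x by (intro mult_left_mono add_mono powr_le_tangent) auto
    finally show ?thesis by simp
  qed (use nn in auto)
  also have "A powr (p/2) \<le> norm m powr p + norm w powr p"
    unfolding A_def norm_powr_via_square[of m] norm_powr_via_square[of w]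
    using assms by (intro powr_add_subadditive) auto
  finally show ?thesis by simp
qed

text \<open>For \<open>p \<ge> 2\<close> the function \<open>s powr (p / 2)\<close> is convex, and
  the expansion around \<open>A\<close> leaves a second-order term in \<open>x = B / A\<close>.
  Cauchy-Schwarz gives \<open>A * x\<^sup>2 \<le> 4 * (norm w)\<^sup>2\<close>, and the remaining
  factor \<open>A powr (a - 1)\<close> is bounded on the ball since
  \<open>a \<ge> 1\<close>.\<close>

lemma norm_powr_midpoint_ge_two:
  fixes p r :: real
  assumes "2 \<le> p" "0 < r"
  shows "\<exists>C\<ge>0. \<forall>m w :: 'a::real_inner. norm m \<le> r \<longrightarrow> norm w \<le> r \<longrightarrow>
    norm (m + w) powr p + norm (m - w) powr p \<le> 2 * norm m powr p + C * (norm w)\<^sup>2"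
proof -
  define a where "a = p / 2"
  obtain n where n: "a \<le> real n" "0 < n" using real_arch_simple[of a] assms
    by (metis a_def divide_pos_pos gr0I less_le_trans not_less of_nat_0 zero_less_numeral)
  define K where "K = (2 * r\<^sup>2) powr (a - 1)"
  \<comment> \<open>\<open>2 * a * K\<close> pays for replacing \<open>A powr a\<close> by
    \<open>norm m powr p\<close> twice, \<open>8 * 3 ^ n * K\<close> for the quadratic remainders of
    the two expansions.\<close>
  define C where "C = (2 * a + 8 * 3 ^ n) * K"
  have a1: "a \<ge> 1" using assms by (simp add: a_def)
  show ?thesis
  proof (intro exI[of _ C] conjI allI impI)
    show C0: "C \<ge> 0" unfolding C_def K_def using a1 by simp
    fix m w :: 'a assume mw: "norm m \<le> r" "norm w \<le> r"
    define A where "A = (norm m)\<^sup>2 + (norm w)\<^sup>2"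
    define B where "B = 2 * (m \<bullet> w)"
    have sq: "(norm (m + w))\<^sup>2 = A + B" "(norm (m - w))\<^sup>2 = A - B"
      unfolding A_def B_def power2_norm_eq_inner by (simp_all add: inner_simps inner_commute)
    have nn: "A + B \<ge> 0" "A - B \<ge> 0" unfolding sq[symmetric] by simp_all
    have "norm (m + w) powr p + norm (m - w) powr p = (A + B) powr a + (A - B) powr a"
      unfolding a_def by (subst (1 2) norm_powr_via_square) (simp add: sq)
    also have "\<dots> \<le> 2 * norm m powr p + C * (norm w)\<^sup>2"
    proof (cases "A = 0")
      case False
      then have A: "A > 0" using nn by auto
      have AK: "A powr (a - 1) \<le> K" unfolding K_def
      proof (intro powr_mono2)
        show "A \<le> 2 * r\<^sup>2" unfolding A_def using mw power_mono[of "norm m" r 2] power_mono[of "norm w" r 2] by simp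
      qed (use a1 A in auto)
      have AA: "A powr a = A powr (a - 1) * A" using A powr_mult_base[of A "a - 1"] by (simp add: mult.commute)
      define x where "x = B / A"
      have x: "\<bar>x\<bar> \<le> 1" "\<bar>-x\<bar> \<le> 1" using nn A by (auto simp: x_def field_simps)
      have e: "A + B = A * (1 + x)" "A - B = A * (1 + -x)" using A by (simp_all add: x_def field_simps)
      have Ax: "A * x\<^sup>2 \<le> 4 * (norm w)\<^sup>2"
      proof -
        have "B\<^sup>2 \<le> 4 * ((norm m)\<^sup>2 * (norm w)\<^sup>2)"
          using Cauchy_Schwarz_ineq[of m w] by (simp add: B_def power_mult_distrib power2_norm_eq_inner)
        also have "\<dots> \<le> 4 * (A * (norm w)\<^sup>2)" unfolding A_def by (intro mult_left_mono mult_right_mono) auto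
        finally show ?thesis using A by (simp add: x_def power2_eq_square field_simps)
      qed
      have Am: "A powr a \<le> norm m powr p + a * K * (norm w)\<^sup>2"
      proof -
        define u where "u = (norm w)\<^sup>2 / A"
        have u: "0 \<le> u" "u \<le> 1" using A by (auto simp: u_def A_def)
        have "A powr a * (1 - a * u) \<le> A powr a * (1 - u) powr a"
          using u a1 by (intro mult_left_mono powr_ge_tangent) auto
        also have "\<dots> = (A * (1 - u)) powr a" using A u by (simp add: powr_mult)
        also have "A * (1 - u) = (norm m)\<^sup>2" using A by (simp add: u_def right_diff_distrib) (simp add: A_def)
        also have "(norm m)\<^sup>2 powr a = norm m powr p" unfolding a_def by (rule norm_powr_via_square[symmetric])
        finally have "A powr a \<le> norm m powr p + a * (A powr a * u)" by (simp add: algebra_simps)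
        also have "A powr a * u = A powr (a - 1) * (norm w)\<^sup>2" unfolding AA using A by (simp add: u_def)
        also have "a * \<dots> \<le> a * (K * (norm w)\<^sup>2)" using AK a1 by (intro mult_left_mono mult_right_mono) auto
        finally show ?thesis by (simp add: mult.assoc)
      qed
      have "(A + B) powr a + (A - B) powr a = A powr a * ((1 + x) powr a + (1 + -x) powr a)"
        unfolding e using A x by (subst (1 2) powr_mult) (auto simp: algebra_simps)
      also have "\<dots> \<le> A powr a * ((1 + a * x + 3 ^ n * x\<^sup>2) + (1 + a * -x + 3 ^ n * (-x)\<^sup>2))"
        using a1 n x by (intro mult_left_mono add_mono powr_le_tangent_plus_square) auto
      also have "\<dots> = 2 * A powr a + 2 * 3 ^ n * (A powr (a - 1) * (A * x\<^sup>2))"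
        by (simp add: AA algebra_simps)
      also have "\<dots> \<le> 2 * (norm m powr p + a * K * (norm w)\<^sup>2) + 2 * 3 ^ n * (K * (4 * (norm w)\<^sup>2))"
      proof -
        have "A powr (a - 1) * (A * x\<^sup>2) \<le> K * (4 * (norm w)\<^sup>2)"
          using AK Ax A by (intro mult_mono[OF AK Ax]) (simp_all add: K_def)
        then show ?thesis using Am by (intro add_mono mult_left_mono) auto
      qed
      also have "\<dots> = 2 * norm m powr p + C * (norm w)\<^sup>2" by (simp add: C_def algebra_simps)
      finally show ?thesis .
    next
      case True
      then show ?thesis using nn C0 by simp
    qed
    finally show "norm (m + w) powr p + norm (m - w) powr p \<le> 2 * norm m powr p + C * (norm w)\<^sup>2" .
  qed
qed

text \<open>For \<open>p < 2\<close> the gradient of the cost is only Hoelder continuous of order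
  \<open>p - 1\<close> at the origin; hence the exponent \<open>min p 2\<close>.\<close>

lemma norm_powr_semiconcave:
  fixes p r :: real
  assumes "1 < p" "0 < r"
  shows "\<exists>C>0. \<forall>x\<^sub>0 x\<^sub>1 y :: 'a::real_inner.
    norm (x\<^sub>0 - y) \<le> r \<longrightarrow> norm (x\<^sub>1 - y) \<le> r \<longrightarrow>
    norm (x\<^sub>0 - y) powr p + norm (x\<^sub>1 - y) powr p
      \<le> 2 * norm ((1/2) *\<^sub>R (x\<^sub>0 + x\<^sub>1) - y) powr p + C * norm (x\<^sub>0 - x\<^sub>1) powr (min p 2)"
proof -
  obtain C where C: "C \<ge> 0" "\<And>m w :: 'a. norm m \<le> r \<Longrightarrow> norm w \<le> r \<Longrightarrow>
    norm (m + w) powr p + norm (m - w) powr p \<le> 2 * norm m powr p + C * norm w powr (min p 2)"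
  proof (cases "p \<le> 2")
    case True
    then show ?thesis using norm_powr_midpoint_le_two[of p] assms by (intro that[of 2]) auto
  next
    case False
    then show ?thesis using norm_powr_midpoint_ge_two[of p r, where 'a='a] assms that by auto
  qed
  show ?thesis
  \<comment> \<open>Adding 1 makes the constant positive even for \<open>C = 0\<close>; the variance
    bound asks for a positive one.\<close>
  proof (intro exI[of _ "C + 1"] conjI allI impI)
    show "C + 1 > 0" using C by simp
    fix x0 x1 y :: 'a assume le: "norm (x0 - y) \<le> r" "norm (x1 - y) \<le> r"
    define m where "m = (1/2) *\<^sub>R (x0 + x1) - y"
    define w where "w = (1/2) *\<^sub>R (x0 - x1)"
    have m2: "m = (1/2) *\<^sub>R ((x0 - y) + (x1 - y))"
      by (simp add: m_def algebra_simps scaleR_2[symmetric])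
    have w2: "w = (1/2) *\<^sub>R ((x0 - y) - (x1 - y))" by (simp add: w_def)
    have "norm m \<le> r" unfolding m2 using norm_triangle_ineq[of "x0 - y" "x1 - y"] le by simp
    moreover have "norm w \<le> r" unfolding w2 using norm_triangle_ineq4[of "x0 - y" "x1 - y"] le by simp
    ultimately have le: "norm (m + w) powr p + norm (m - w) powr p \<le> 2 * norm m powr p + C * norm w powr (min p 2)"
      by (rule C)
    have eq: "m + w = x0 - y" "m - w = x1 - y"
      by (simp_all add: m_def w_def algebra_simps flip: scaleR_add_left)
    have "C * norm w powr (min p 2) \<le> (C + 1) * norm (x0 - x1) powr (min p 2)"
      using C(1) assms by (intro mult_mono powr_mono2) (auto simp: w_def)
    then show "norm (x0 - y) powr p + norm (x1 - y) powr p
      \<le> 2 * norm ((1/2) *\<^sub>R (x0 + x1) - y) powr p + (C + 1) * norm (x0 - x1) powr (min p 2)"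
      using le unfolding eq m_def[symmetric] by linarith
  qed
qed

lemma norm_powr_lipschitz:
  fixes p r :: real
  assumes "1 < p" "0 < r"
  shows "\<exists>L>0. \<forall>a b :: 'a::real_normed_vector. norm a \<le> r \<longrightarrow> norm b \<le> r \<longrightarrow>
    \<bar>norm a powr p - norm b powr p\<bar> \<le> L * norm (a - b)"
proof -
  \<comment> \<open>The largest derivative of \<open>s powr p\<close> on the interval from 0 to
    \<open>r\<close>. The tangent bound at \<open>t / s\<close> takes the place of the mean value
    theorem.\<close>
  define L where "L = p * r powr (p - 1)"
  have mono: "s powr p - t powr p \<le> L * (s - t)" if "0 \<le> t" "t \<le> s" "s \<le> r" for s t
  proof (cases "s = 0")
    case False
    then have s: "s > 0" using that by simp
    have "s powr p * (1 - p * ((s - t) / s)) \<le> s powr p * (1 - (s - t) / s) powr p"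
      using that s assms by (intro mult_left_mono powr_ge_tangent) auto
    also have "\<dots> = t powr p" using s that by (simp add: powr_mult[symmetric] field_simps)
    finally have "s powr p - t powr p \<le> p * (s powr p / s) * (s - t)"
      by (simp add: algebra_simps)
    also have "s powr p / s = s powr (p - 1)" using s by (simp add: powr_diff)
    also have "p * s powr (p - 1) * (s - t) \<le> L * (s - t)"
      unfolding L_def using that assms s by (intro mult_right_mono mult_left_mono powr_mono2) auto
    finally show ?thesis .
  qed (use that in auto)
  show ?thesis
  proof (intro exI[of _ L] conjI allI impI)
    show "L > 0" using assms by (simp add: L_def)
    fix a b :: 'a assume ab: "norm a \<le> r" "norm b \<le> r"
    have "\<bar>norm a powr p - norm b powr p\<bar> \<le> L * \<bar>norm a - norm b\<bar>"
    proof (cases "norm b \<le> norm a")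
      case True
      then have "norm b powr p \<le> norm a powr p" using assms by (intro powr_mono2) auto
      then show ?thesis using mono[of "norm b" "norm a"] ab True by auto
    next
      case False
      then have "norm a powr p \<le> norm b powr p" using assms by (intro powr_mono2) auto
      then show ?thesis using mono[of "norm a" "norm b"] ab False by auto
    qed
    also have "\<dots> \<le> L * norm (a - b)" using assms by (intro mult_left_mono norm_triangle_ineq3) (auto simp: L_def)
    finally show "\<bar>norm a powr p - norm b powr p\<bar> \<le> L * norm (a - b)" .
  qed
qed

section \<open>Variance bounds under log-concave measures\<close>

lemma lower_semicontinuous_borel_measurable:
  assumes "lower_semicontinuous V"
  shows "V \<in> borel_measurable borel"
proof (rule borel_measurableI_greater)
  show "{x \<in> space borel. y < V x} \<in> sets borel" for y
    using assms by (auto simp: lower_semicontinuous_def)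
qed

lemma exp_minus_midpoint:
  assumes "ereal_convex V" "\<And>x. V x \<noteq> -\<infinity>"
  shows "exp_minus (V x) * exp_minus (V y) \<le> (exp_minus (V ((1/2) *\<^sub>R (x + y))))\<^sup>2"
proof (cases "V x = \<infinity> \<or> V y = \<infinity>")
  case True
  then show ?thesis by (auto simp: exp_minus_def)
next
  case False
  then obtain u v where uv: "V x = ereal u" "V y = ereal v"
    using assms(2) by (metis ereal_cases)
  have "V ((1 - 1/2) *\<^sub>R x + (1/2) *\<^sub>R y) \<le> ereal (1 - 1/2) * V x + ereal (1/2) * V y"
    using assms(1)[unfolded ereal_convex_def, rule_format, of "1/2" x y] by simp
  then have le: "V ((1/2) *\<^sub>R (x + y)) \<le> ereal ((u + v) / 2)"
    by (simp add: uv scaleR_add_right add_divide_distrib)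
  then obtain w where w: "V ((1/2) *\<^sub>R (x + y)) = ereal w"
    using assms(2) by (metis ereal_cases ereal_infty_less_eq(1) PInfty_neq_ereal(1))
  have "exp (- u) * exp (- v) \<le> (exp (- w))\<^sup>2"
    using le by (simp add: w exp_add[symmetric] exp_double[symmetric])
  then show ?thesis by (simp add: uv w exp_minus_def)
qed

lemma log_concave_measure_sets: "log_concave_measure M \<Longrightarrow> sets M = sets borel"
  by (auto simp: log_concave_measure_def)

text \<open>Both the indicator of the convex set \<open>X\<close> and \<open>exp_minus (V x)\<close>
  are log-concave, so the midpoint condition survives multiplication by them and has to be checked
  on \<open>X\<close> only. The error \<open>\<delta>\<close> is absorbed into
  \<open>h + \<delta>\<close> and leaves the integral as a factor.\<close>

lemma log_concave_prekopa_leindler: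
  fixes M :: "'a::euclidean_space measure"
  assumes M: "log_concave_measure M" and X: "convex X" "closed X" "AE x in M. x \<in> X"
    and [measurable]: "f \<in> borel_measurable borel" "g \<in> borel_measurable borel" "h \<in> borel_measurable borel"
    and mid: "\<And>x y. x \<in> X \<Longrightarrow> y \<in> X \<Longrightarrow> f x + g y \<le> 2 * h ((1/2) *\<^sub>R (x + y)) + 2 * \<delta>"
  shows "(\<integral>\<^sup>+x. exp (f x) \<partial>M) * (\<integral>\<^sup>+x. exp (g x) \<partial>M) \<le> ennreal (exp (2 * \<delta>)) * (\<integral>\<^sup>+x. exp (h x) \<partial>M)\<^sup>2"
proof -
  obtain V where V: "\<And>x. V x \<noteq> -\<infinity>" "ereal_convex V" "lower_semicontinuous V"
    and Meq: "M = density lborel (\<lambda>x. ennreal (exp_minus (V x)))"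
    using M unfolding log_concave_measure_def by blast
  note [measurable] = lower_semicontinuous_borel_measurable[OF V(3)]
  note [measurable_cong] = log_concave_measure_sets[OF M]
  have [measurable]: "(\<lambda>x. exp_minus (V x)) \<in> borel_measurable borel" unfolding exp_minus_def by measurable
  have [measurable]: "X \<in> sets borel" using X by auto
  have int: "(\<integral>\<^sup>+x. exp (k x) \<partial>M) = (\<integral>\<^sup>+x. ennreal (indicator X x * exp_minus (V x) * exp (k x)) \<partial>lborel)"
    if [measurable]: "k \<in> borel_measurable borel" for k :: "'a \<Rightarrow> real"
  proof -
    have "(\<integral>\<^sup>+x. exp (k x) \<partial>M) = (\<integral>\<^sup>+x. indicator X x * ennreal (exp (k x)) \<partial>M)"
      using X(3) by (intro nn_integral_cong_AE) auto
    also have "\<dots> = (\<integral>\<^sup>+x. ennreal (indicator X x * exp_minus (V x) * exp (k x)) \<partial>lborel)"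
      unfolding Meq by (subst nn_integral_density)
        (auto intro!: nn_integral_cong simp: indicator_def ennreal_mult' exp_minus_def)
    finally show ?thesis .
  qed
  have "(\<integral>\<^sup>+x. ennreal (indicator X x * exp_minus (V x) * exp (f x)) \<partial>lborel) *
      (\<integral>\<^sup>+x. ennreal (indicator X x * exp_minus (V x) * exp (g x)) \<partial>lborel)
    \<le> (\<integral>\<^sup>+x. ennreal (indicator X x * exp_minus (V x) * exp (h x + \<delta>)) \<partial>lborel)\<^sup>2"
  proof (rule prekopa_leindler_midpoint)
    fix x y :: 'a
    let ?z = "(1/2) *\<^sub>R (x + y)"
    have "(indicator X x * exp_minus (V x) * exp (f x)) * (indicator X y * exp_minus (V y) * exp (g y))
      \<le> (indicator X ?z * exp_minus (V ?z) * exp (h ?z + \<delta>))\<^sup>2"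
    proof (cases "x \<in> X \<and> y \<in> X")
      case True
      then have z: "?z \<in> X" using convexD[OF X(1), of x y "1/2" "1/2"] by (simp add: scaleR_add_right)
      have "(exp_minus (V x) * exp_minus (V y)) * exp (f x + g y)
        \<le> (exp_minus (V ?z))\<^sup>2 * (exp (h ?z + \<delta>))\<^sup>2"
        using True V mid[of x y]
        by (intro mult_mono exp_minus_midpoint) (auto simp: exp_minus_def exp_double[symmetric])
      moreover have "exp (f x + g y) = exp (f x) * exp (g y)" by (rule exp_add)
      ultimately show ?thesis using True z by (simp add: power_mult_distrib mult_ac)
    qed auto
    then show "ennreal (indicator X x * exp_minus (V x) * exp (f x)) * ennreal (indicator X y * exp_minus (V y) * exp (g y))
      \<le> (ennreal (indicator X ?z * exp_minus (V ?z) * exp (h ?z + \<delta>)))\<^sup>2"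
      by (simp add: ennreal_mult'[symmetric] ennreal_power exp_minus_def ennreal_leI)
  qed measurable
  also have "\<dots> = (\<integral>\<^sup>+x. exp (h x + \<delta>) \<partial>M)\<^sup>2" by (simp add: int)
  also have "(\<integral>\<^sup>+x. exp (h x + \<delta>) \<partial>M) = exp \<delta> * (\<integral>\<^sup>+x. exp (h x) \<partial>M)"
  proof -
    have "(\<integral>\<^sup>+x. exp (h x + \<delta>) \<partial>M) = (\<integral>\<^sup>+x. ennreal (exp \<delta>) * ennreal (exp (h x)) \<partial>M)"
      by (simp add: exp_add ennreal_mult'[symmetric] mult.commute)
    also have "\<dots> = exp \<delta> * (\<integral>\<^sup>+x. exp (h x) \<partial>M)"
      by (intro nn_integral_cmult) measurable
    finally show ?thesis .
  qed
  finally show ?thesis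
    by (simp add: int power_mult_distrib ennreal_power exp_double)
qed

lemma exp_ge_quadratic:
  fixes u :: real
  assumes "\<bar>u\<bar> \<le> c"
  shows "1 + u + exp (- c) / 2 * u\<^sup>2 \<le> exp u"
proof -
  obtain t where t: "\<bar>t\<bar> \<le> \<bar>u\<bar>" "exp u = (\<Sum>m<2. u ^ m / fact m) + exp t / fact 2 * u ^ 2"
    using Maclaurin_exp_le[of u 2] by blast
  have "exp (- c) / 2 * u\<^sup>2 \<le> exp t / 2 * u\<^sup>2"
    using t assms by (intro mult_right_mono) auto
  then show ?thesis unfolding t(2) by (simp add: numeral_2_eq_2)
qed

text \<open>With \<open>b\<close> centred, each factor on the left exceeds \<open>Z\<close> by a
  multiple of the second moment of \<open>b - m\<close>, up to a multiple of the integral of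
  \<open>D\<close>. A product of at most \<open>exp (2 * \<delta>) * Z\<^sup>2\<close> leaves no
  room for a large second moment.\<close>

lemma (in prob_space) variance_le_of_laplace_product:
  fixes \<Phi> b D :: "'a \<Rightarrow> real"
  assumes [measurable]: "\<Phi> \<in> borel_measurable M" "b \<in> borel_measurable M" "D \<in> borel_measurable M"
    and bdd: "AE x in M. \<bar>\<Phi> x\<bar> \<le> S" "AE x in M. \<bar>b x\<bar> \<le> B" "AE x in M. 0 \<le> D x \<and> D x \<le> T"
    and \<delta>: "0 \<le> \<delta>"
    and laplace: "(\<integral>x. exp (\<Phi> x + b x - D x / 2) \<partial>M) * (\<integral>x. exp (\<Phi> x - b x - D x / 2) \<partial>M)
      \<le> exp (2 * \<delta>) * (\<integral>x. exp (\<Phi> x) \<partial>M)\<^sup>2"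
  shows "\<exists>m. (\<integral>x. (b x - m)\<^sup>2 \<partial>M) \<le> exp (4 * B + 2 * S) * (\<integral>x. D x \<partial>M) + 2 * exp (2 * B + 2 * S) * (exp \<delta> - 1)"
proof -

  define Z where "Z = (\<integral>x. exp (\<Phi> x) \<partial>M)"
  \<comment> \<open>Centering \<open>b\<close> under the Gibbs measure \<open>exp \<Phi> / Z\<close> leaves the product in \<open>laplace\<close> unchanged and
    removes the first-order term of both factors.\<close>
  define m where "m = (\<integral>x. exp (\<Phi> x) * b x \<partial>M) / Z"
  define u where "u x = b x - m" for x
  have [measurable]: "u \<in> borel_measurable M" unfolding u_def by measurable
  have intb: "integrable M f" if "f \<in> borel_measurable M" "AE x in M. \<bar>f x\<bar> \<le> K" for f :: "'a \<Rightarrow> real" and K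
    using that by (intro integrable_const_bound[of _ K]) auto
  have expS: "AE x in M. exp (\<Phi> x) \<le> exp S" "AE x in M. exp (- S) \<le> exp (\<Phi> x)" using bdd(1) by auto
  have iE: "integrable M (\<lambda>x. exp (\<Phi> x))" using expS by (intro intb[of _ "exp S"]) auto
  have iEb: "integrable M (\<lambda>x. exp (\<Phi> x) * b x)"
    using expS bdd(2) by (intro intb[of _ "exp S * B"]) (auto simp: abs_mult intro!: mult_mono)
  have ZS: "exp (- S) \<le> Z" "Z \<le> exp S"
  proof -
    show "Z \<le> exp S" unfolding Z_def using integral_mono_AE[OF iE, of "\<lambda>_. exp S"] expS by (simp add: prob_space)
    show "exp (- S) \<le> Z" unfolding Z_def using integral_mono_AE[OF _ iE, of "\<lambda>_. exp (- S)"] expS by (simp add: prob_space)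
  qed
  then have Z0: "Z > 0" using exp_gt_zero[of "- S"] by linarith
  have mB: "\<bar>m\<bar> \<le> B"
  proof -
    have "\<bar>\<integral>x. exp (\<Phi> x) * b x \<partial>M\<bar> \<le> (\<integral>x. \<bar>exp (\<Phi> x) * b x\<bar> \<partial>M)" by (rule integral_abs_bound)
    also have "\<dots> \<le> (\<integral>x. exp (\<Phi> x) * B \<partial>M)"
    proof (rule integral_mono_AE)
      show "integrable M (\<lambda>x. \<bar>exp (\<Phi> x) * b x\<bar>)" using iEb by (rule integrable_abs)
      show "integrable M (\<lambda>x. exp (\<Phi> x) * B)" using iE by simp
    qed (use bdd(2) in \<open>auto simp: abs_mult\<close>)
    also have "\<dots> = Z * B" by (simp add: Z_def)
    finally show ?thesis unfolding m_def using Z0 by (simp add: abs_divide field_simps)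
  qed
  have uB: "AE x in M. \<bar>u x\<bar> \<le> 2 * B" using bdd(2)
  proof (rule AE_mp, intro AE_I2 impI)
    fix x assume "\<bar>b x\<bar> \<le> B"
    then show "\<bar>u x\<bar> \<le> 2 * B" unfolding u_def using mB by linarith
  qed
  have iu: "integrable M (\<lambda>x. exp (\<Phi> x) * u x)"
    using expS uB by (intro intb[of _ "exp S * (2 * B)"]) (auto simp: abs_mult intro!: mult_mono)
  have uB2: "AE x in M. (u x)\<^sup>2 \<le> (2 * B)\<^sup>2" using uB
  proof eventually_elim
    case (elim x)
    then show ?case using power_mono[of "\<bar>u x\<bar>" "2 * B" 2] by simp
  qed
  have iu2: "integrable M (\<lambda>x. (u x)\<^sup>2)"
    using uB2 by (intro intb[of _ "(2 * B)\<^sup>2"]) auto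
  have iEu2: "integrable M (\<lambda>x. exp (\<Phi> x) * (u x)\<^sup>2)"
    using expS uB2 by (intro intb[of _ "exp S * (2 * B)\<^sup>2"]) (auto simp: abs_mult intro!: mult_mono)
  have iD: "integrable M D" using bdd(3) by (intro intb[of _ T]) auto
  have iED: "integrable M (\<lambda>x. exp (\<Phi> x) * D x)"
    using expS bdd(3) by (intro intb[of _ "exp S * T"]) (auto simp: abs_mult intro!: mult_mono)
  have u0: "(\<integral>x. exp (\<Phi> x) * u x \<partial>M) = 0"
  proof -
    have "(\<integral>x. exp (\<Phi> x) * u x \<partial>M) = (\<integral>x. exp (\<Phi> x) * b x - m * exp (\<Phi> x) \<partial>M)"
      by (simp add: u_def algebra_simps)
    also have "\<dots> = 0" using iEb iE Z0 by (simp add: m_def Z_def[symmetric])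
    finally show ?thesis .
  qed
  define V where "V = (\<integral>x. (u x)\<^sup>2 \<partial>M)"
  define I where "I = (\<integral>x. D x \<partial>M)"
  \<comment> \<open>The part of the expansion common to both signs of \<open>u\<close>. The factors
    with \<open>2 * B\<close> come from the bound on \<open>u\<close>, those with \<open>S\<close>
    from the bound on \<open>\<Phi>\<close>.\<close>
  define Q where "Q = Z + exp (- (2 * B)) / 2 * exp (- S) * V - exp (2 * B) / 2 * exp S * I"
  have lower: "Q \<le> (\<integral>x. exp (\<Phi> x + s * u x - D x / 2) \<partial>M)" if s: "s = 1 \<or> s = -1" for s
  proof -
    let ?l = "\<lambda>x. exp (\<Phi> x) + s * (exp (\<Phi> x) * u x) + exp (- (2 * B)) / 2 * (exp (\<Phi> x) * (u x)\<^sup>2) - exp (2 * B) / 2 * (exp (\<Phi> x) * D x)"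
    have "exp (- S) * V \<le> (\<integral>x. exp (\<Phi> x) * (u x)\<^sup>2 \<partial>M)"
      unfolding V_def integral_mult_right_zero[symmetric]
    proof (rule integral_mono_AE)
      show "AE x in M. exp (- S) * (u x)\<^sup>2 \<le> exp (\<Phi> x) * (u x)\<^sup>2"
        using expS(2) by eventually_elim (rule mult_right_mono, auto)
    qed (use iu2 iEu2 in auto)
    moreover have "(\<integral>x. exp (\<Phi> x) * D x \<partial>M) \<le> exp S * I"
      unfolding I_def integral_mult_right_zero[symmetric]
    proof (rule integral_mono_AE)
      show "AE x in M. exp (\<Phi> x) * D x \<le> exp S * D x"
        using expS(1) bdd(3) by eventually_elim (rule mult_right_mono, auto)
    qed (use iD iED in auto)
    ultimately have "Q \<le> Z + s * (\<integral>x. exp (\<Phi> x) * u x \<partial>M) + exp (- (2 * B)) / 2 * (\<integral>x. exp (\<Phi> x) * (u x)\<^sup>2 \<partial>M)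
        - exp (2 * B) / 2 * (\<integral>x. exp (\<Phi> x) * D x \<partial>M)"
      unfolding Q_def u0 mult.assoc by (intro diff_mono add_mono mult_left_mono) auto
    also have "\<dots> = (\<integral>x. ?l x \<partial>M)" unfolding Z_def using iE iu iEu2 iED by simp
    also have "\<dots> \<le> (\<integral>x. exp (\<Phi> x + s * u x - D x / 2) \<partial>M)"
    proof (rule integral_mono_AE)
      show "integrable M ?l" using iE iu iEu2 iED by simp
      show "integrable M (\<lambda>x. exp (\<Phi> x + s * u x - D x / 2))"
      proof (rule intb[of _ "exp (S + 2 * B)"])
        show "AE x in M. \<bar>exp (\<Phi> x + s * u x - D x / 2)\<bar> \<le> exp (S + 2 * B)"
          using bdd(1,3) uB
        proof eventually_elim
          case (elim x)
          then have "s * u x \<le> 2 * B" using s by auto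
          then have "\<Phi> x + s * u x - D x / 2 \<le> S + 2 * B" using elim by linarith
          then show ?case by simp
        qed
      qed measurable
      show "AE x in M. ?l x \<le> exp (\<Phi> x + s * u x - D x / 2)"
        using bdd(3) uB
      proof eventually_elim
        case (elim x)
        have su: "\<bar>s * u x\<bar> \<le> 2 * B" "(s * u x)\<^sup>2 = (u x)\<^sup>2" using s elim by auto
        \<comment> \<open>\<open>D\<close> enters to first order only, through
          \<open>exp (- D / 2) \<ge> 1 - D / 2\<close>, so its prefactor may be replaced by the
          upper bound \<open>exp (2 * B)\<close>; the quadratic gain is kept in the other
          term.\<close>
        have "1 + s * u x + exp (- (2 * B)) / 2 * (u x)\<^sup>2 - exp (2 * B) / 2 * D x
          \<le> exp (s * u x) - exp (s * u x) * (D x / 2)"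
        proof -
          have "exp (s * u x) * (D x / 2) \<le> exp (2 * B) * (D x / 2)"
            using su elim by (intro mult_right_mono) auto
          then show ?thesis using exp_ge_quadratic[OF su(1)] unfolding su(2) by simp
        qed
        also have "\<dots> = exp (s * u x) * (1 + - (D x / 2))" by (simp add: algebra_simps)
        also have "\<dots> \<le> exp (s * u x) * exp (- (D x / 2))"
          by (intro mult_left_mono exp_ge_add_one_self) auto
        finally have "exp (\<Phi> x) * (1 + s * u x + exp (- (2 * B)) / 2 * (u x)\<^sup>2 - exp (2 * B) / 2 * D x)
          \<le> exp (\<Phi> x) * (exp (s * u x) * exp (- (D x / 2)))" by (intro mult_left_mono) auto
        then show ?case by (simp add: exp_add[symmetric] algebra_simps)
      qed
    qed
    finally show ?thesis .
  qed
  have eq1: "(\<integral>x. exp (\<Phi> x + b x - D x / 2) \<partial>M) = exp m * (\<integral>x. exp (\<Phi> x + 1 * u x - D x / 2) \<partial>M)"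
    unfolding integral_mult_right_zero[symmetric]
    by (intro Bochner_Integration.integral_cong refl) (simp add: u_def exp_add[symmetric] algebra_simps)
  have eq2: "(\<integral>x. exp (\<Phi> x - b x - D x / 2) \<partial>M) = exp (- m) * (\<integral>x. exp (\<Phi> x + (-1) * u x - D x / 2) \<partial>M)"
    unfolding integral_mult_right_zero[symmetric]
    by (intro Bochner_Integration.integral_cong refl) (simp add: u_def exp_add[symmetric] algebra_simps)
  have "(\<integral>x. exp (\<Phi> x + 1 * u x - D x / 2) \<partial>M) * (\<integral>x. exp (\<Phi> x + (-1) * u x - D x / 2) \<partial>M) \<le> (exp \<delta> * Z)\<^sup>2"
    (is "?P * ?N \<le> _")
  proof -
    have "(exp m * ?P) * (exp (- m) * ?N) = (exp m * exp (- m)) * (?P * ?N)" by (simp only: mult_ac)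
    also have "exp m * exp (- m) = 1" by (simp flip: exp_add)
    finally have "?P * ?N = (exp m * ?P) * (exp (- m) * ?N)" by (simp only: mult_1)
    also have "\<dots> \<le> (exp \<delta> * Z)\<^sup>2"
      using laplace unfolding eq1 eq2 power_mult_distrib Z_def[symmetric] exp_double .
    finally show ?thesis .
  qed
  \<comment> \<open>If \<open>Q\<close> exceeded the positive number
    \<open>exp \<delta> * Z\<close>, so would both factors, and their product would exceed its
    square.\<close>
  have Qle: "Q \<le> exp \<delta> * Z"
  proof (rule ccontr)
    assume n: "\<not> Q \<le> exp \<delta> * Z"
    have "(exp \<delta> * Z) * (exp \<delta> * Z) < ?P * ?N"
      using n lower[of 1] lower[of "-1"] Z0 by (intro mult_strict_mono') auto
    then show False using \<open>?P * ?N \<le> _\<close> by (simp add: power2_eq_square)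
  qed
  then have "exp (- (2 * B)) / 2 * exp (- S) * V \<le> exp (2 * B) / 2 * exp S * I + (exp \<delta> - 1) * Z"
    by (simp add: Q_def algebra_simps)
  also have "(exp \<delta> - 1) * Z \<le> (exp \<delta> - 1) * exp S" using ZS \<delta> by (intro mult_left_mono) auto
  finally have scaled: "(2 * exp (2 * B + S)) * (exp (- (2 * B)) / 2 * exp (- S) * V)
    \<le> (2 * exp (2 * B + S)) * (exp (2 * B) / 2 * exp S * I + (exp \<delta> - 1) * exp S)"
    by (intro mult_left_mono) auto
  have lhs: "(2 * exp (2 * B + S)) * (exp (- (2 * B)) / 2 * exp (- S) * V) = V"
    by (simp add: exp_add exp_minus field_simps)
  have rhs: "(2 * exp (2 * B + S)) * (exp (2 * B) / 2 * exp S * I + (exp \<delta> - 1) * exp S)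
    = exp (4 * B + 2 * S) * I + 2 * exp (2 * B + 2 * S) * (exp \<delta> - 1)"
  proof -
    have "exp (4 * B + 2 * S) = exp (2 * B + S) * (exp (2 * B) * exp S)"
      "exp (2 * B + 2 * S) = exp (2 * B + S) * exp S"
      by (simp_all flip: exp_add)
    then show ?thesis by (simp add: algebra_simps)
  qed
  show ?thesis using scaled[unfolded lhs rhs] unfolding V_def u_def I_def by blast
qed

lemma AE_bounded_of_continuous:
  fixes u :: "'a::euclidean_space \<Rightarrow> real"
  assumes "continuous_on UNIV u" "AE x in M. norm x \<le> R"
  shows "\<exists>K. AE x in M. \<bar>u x\<bar> \<le> K"
proof -
  have "bounded (u ` cball 0 R)"
    using assms(1) by (intro compact_imp_bounded compact_continuous_image) (auto intro: continuous_on_subset)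
  then obtain K where "\<forall>z\<in>u ` cball 0 R. norm z \<le> K" unfolding bounded_iff by blast
  then have "AE x in M. \<bar>u x\<bar> \<le> K" using assms(2) by auto
  then show ?thesis by blast
qed

lemma integrable_of_continuous:
  fixes u :: "'a::euclidean_space \<Rightarrow> real"
  assumes "finite_measure M" "sets M = sets borel" "continuous_on UNIV u" "AE x in M. norm x \<le> R"
  shows "integrable M u"
proof -
  interpret finite_measure M by fact
  note [measurable_cong] = assms(2)
  have [measurable]: "u \<in> borel_measurable borel" using assms(3) by (rule borel_measurable_continuous_onI)
  obtain K where "AE x in M. \<bar>u x\<bar> \<le> K" using AE_bounded_of_continuous[OF assms(3,4)] by blast
  then show ?thesis by (intro integrable_const_bound[of _ K]) auto
qed

text \<open>One term suffices on each side of \<open>t = \<epsilon>\<close>; beyond it the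
  comparison uses that the exponent \<open>q - 2\<close> is not positive.\<close>

lemma powr_le_square_plus:
  fixes t \<epsilon> q :: real
  assumes "0 \<le> t" "0 < \<epsilon>" "0 < q" "q \<le> 2"
  shows "t powr q \<le> \<epsilon> powr (q - 2) * t\<^sup>2 + \<epsilon> powr q"
proof (cases "t \<le> \<epsilon>")
  case True
  then have "t powr q \<le> \<epsilon> powr q" using assms by (intro powr_mono2) auto
  then show ?thesis using assms by (simp add: add_increasing)
next
  case False
  then have "t > 0" using assms by simp
  then have "t powr q = t powr (q - 2) * t\<^sup>2" by (simp add: powr_diff)
  also have "\<dots> \<le> \<epsilon> powr (q - 2) * t\<^sup>2"
    using False assms by (intro mult_right_mono powr_mono2') auto
  finally show ?thesis by (simp add: add_increasing2)
qed

text \<open>\<open>E\<close> caps the scale so that one constant serves all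
  \<open>\<epsilon>\<close>. The constant is chosen before the functions, which enter only through
  their Lipschitz bound and the midpoint inequality.\<close>

lemma semiconcave_variance_bound:
  fixes M :: "'a::euclidean_space measure"
  assumes "prob_space M" and lc: "log_concave_measure M" and R: "AE x in M. norm x \<le> R" "0 \<le> R"
    and "0 \<le> L" "0 < C\<^sub>1" and q: "1 < q" "q \<le> 2"
  shows "\<exists>C. \<forall>f\<^sub>0 f\<^sub>1 f \<epsilon>. 0 < \<epsilon> \<longrightarrow> \<epsilon> \<le> E \<longrightarrow>
    L-lipschitz_on UNIV f\<^sub>0 \<longrightarrow> L-lipschitz_on UNIV f\<^sub>1 \<longrightarrow> L-lipschitz_on UNIV f \<longrightarrow>
    (\<forall>x y. norm x \<le> R \<longrightarrow> norm y \<le> R \<longrightarrow>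
      f\<^sub>0 x + f\<^sub>1 y \<le> 2 * f ((1/2) *\<^sub>R (x + y)) + C\<^sub>1 * norm (x - y) powr q) \<longrightarrow>
    (\<exists>m. (\<integral>x. (f\<^sub>0 x - f\<^sub>1 x - m)\<^sup>2 \<partial>M)
      \<le> C * (\<epsilon> powr (q - 2) * (\<integral>x. 2 * f x - f\<^sub>0 x - f\<^sub>1 x \<partial>M) + \<epsilon> powr (2 * q - 2)))"
proof -
  interpret prob_space M by fact
  note sets_M [measurable_cong] = log_concave_measure_sets[OF lc]
  \<comment> \<open>\<open>T\<close> bounds the scaling factor
    \<open>\<epsilon> powr (2 - q)\<close>. Then \<open>B\<close> and \<open>S\<close> bound
    \<open>b\<close> and \<open>\<Phi>\<close> on the ball, where an \<open>L\<close>-Lipschitz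
    function differs from its value at 0 by at most \<open>L * R\<close>.\<close>
  define T where "T = E powr (2 - q)"
  define B where "B = T * (L * R)"
  define S where "S = T * (L * R) + 2 * C\<^sub>1 * R\<^sup>2"
  \<comment> \<open>The constants of \<open>variance_le_of_laplace_product\<close> times 4, since
    \<open>f0 - f1\<close> is twice \<open>k\<close>; \<open>K\<^sub>2\<close> also contains the
    bound on \<open>exp \<delta> - 1\<close>, divided by \<open>\<epsilon>\<^sup>2\<close>.\<close>
  define K\<^sub>1 where "K\<^sub>1 = 4 * exp (4 * B + 2 * S)"
  define K\<^sub>2 where "K\<^sub>2 = 4 * exp (2 * B + 2 * S) * C\<^sub>1 * exp (C\<^sub>1 * E\<^sup>2 / 2)"
  define C where "C = max K\<^sub>1 K\<^sub>2"
  show ?thesis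
  proof (rule exI[of _ C], intro allI impI)
    fix f0 f1 f :: "'a \<Rightarrow> real" and \<epsilon> :: real
    assume \<epsilon>: "0 < \<epsilon>" "\<epsilon> \<le> E"
      and lip: "L-lipschitz_on UNIV f0" "L-lipschitz_on UNIV f1" "L-lipschitz_on UNIV f"
      and mid: "\<forall>x y. norm x \<le> R \<longrightarrow> norm y \<le> R \<longrightarrow>
        f0 x + f1 y \<le> 2 * f ((1/2) *\<^sub>R (x + y)) + C\<^sub>1 * norm (x - y) powr q"
    note cont [continuous_intros] = lip[THEN lipschitz_on_continuous_on]
    define t where "t = \<epsilon> powr (2 - q)"
    define k where "k x = (f0 x - f1 x) / 2" for x
    \<comment> \<open>\<open>t\<close> times the semiconcavity constant \<open>2 * C\<^sub>1 * \<epsilon> powr (q - 2)\<close> at scale \<open>\<epsilon>\<close> is \<open>2 * C\<^sub>1\<close>, so \<open>\<Phi>\<close> is bounded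
      independently of \<open>\<epsilon>\<close>; the constants are arranged so that \<open>\<Phi> \<plusminus> b - D / 2\<close> is \<open>t * f\<^sub>0\<close>, respectively \<open>t * f\<^sub>1\<close>,
      up to the quadratic term and additive constants.\<close>
    define \<Phi> where "\<Phi> x = t * (f x - f 0) - 2 * C\<^sub>1 * (norm x)\<^sup>2" for x
    define b where "b x = t * (k x - k 0)" for x
    define D where "D x = t * (2 * f x - f0 x - f1 x)" for x
    define \<delta> where "\<delta> = C\<^sub>1 * \<epsilon>\<^sup>2 / 2"
    have t: "t > 0" "t \<le> T" using \<epsilon> q unfolding t_def T_def by (auto intro: powr_mono2)
    have te: "t * \<epsilon> powr (q - 2) = 1" "t * \<epsilon> powr q = \<epsilon>\<^sup>2" "1 / t = \<epsilon> powr (q - 2)"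
      using \<epsilon> unfolding t_def
      by (simp_all add: powr_add[symmetric] powr_minus_divide[symmetric] flip: powr_numeral)
    have te': "\<epsilon>\<^sup>2 / t\<^sup>2 = \<epsilon> powr (2 * q - 2)"
    proof -
      have "\<epsilon>\<^sup>2 = \<epsilon> powr 2" using \<epsilon> by simp
      moreover have "t\<^sup>2 = \<epsilon> powr (2 * (2 - q))"
        using \<epsilon> powr_powr[of \<epsilon> "2 - q" 2] by (simp add: t_def mult.commute)
      ultimately have "\<epsilon>\<^sup>2 / t\<^sup>2 = \<epsilon> powr (2 - 2 * (2 - q))" by (simp only: powr_diff)
      then show ?thesis by (simp add: algebra_simps)
    qed
    have bound: "\<bar>g x - g 0\<bar> \<le> L * R" if "L-lipschitz_on UNIV g" "norm x \<le> R" for g :: "'a \<Rightarrow> real" and x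
    proof -
      have "\<bar>g x - g 0\<bar> \<le> L * norm x"
        using lipschitz_onD[OF that(1), of x 0] by (simp add: dist_real_def)
      also have "\<dots> \<le> L * R" using that \<open>0 \<le> L\<close> by (intro mult_left_mono) auto
      finally show ?thesis .
    qed
    have c\<Phi> [continuous_intros]: "continuous_on UNIV \<Phi>" unfolding \<Phi>_def by (intro continuous_intros)
    have cb [continuous_intros]: "continuous_on UNIV b" unfolding b_def k_def by (intro continuous_intros) auto
    have cD [continuous_intros]: "continuous_on UNIV D" unfolding D_def by (intro continuous_intros)
    have [measurable]: "\<Phi> \<in> borel_measurable borel" "b \<in> borel_measurable borel" "D \<in> borel_measurable borel"
      using c\<Phi> cb cD by (auto intro: borel_measurable_continuous_onI)
    have \<Phi>S: "AE x in M. \<bar>\<Phi> x\<bar> \<le> S" using R(1)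
    proof eventually_elim
      case (elim x)
      have "\<bar>t * (f x - f 0)\<bar> \<le> T * (L * R)"
        unfolding abs_mult using t bound[OF lip(3) elim] by (intro mult_mono) auto
      moreover have "C\<^sub>1 * (norm x)\<^sup>2 \<le> C\<^sub>1 * R\<^sup>2"
        using elim \<open>0 < C\<^sub>1\<close> by (intro mult_left_mono power_mono) auto
      moreover have "0 \<le> C\<^sub>1 * (norm x)\<^sup>2" using \<open>0 < C\<^sub>1\<close> by simp
      ultimately show ?case unfolding \<Phi>_def S_def by linarith
    qed
    have bB: "AE x in M. \<bar>b x\<bar> \<le> B" using R(1)
    proof eventually_elim
      case (elim x)
      have "\<bar>k x - k 0\<bar> \<le> L * R"
        using bound[OF lip(1) elim] bound[OF lip(2) elim] unfolding k_def by (simp add: field_simps)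
      then show ?case unfolding b_def B_def abs_mult using t by (intro mult_mono) auto
    qed
    obtain T' where T': "AE x in M. \<bar>D x\<bar> \<le> T'" using AE_bounded_of_continuous[OF cD R(1)] by blast
    have DT: "AE x in M. 0 \<le> D x \<and> D x \<le> T'" using T' R(1)
    proof eventually_elim
      case (elim x)
      have "f0 x + f1 x \<le> 2 * f x" using mid[rule_format, of x x] elim by (simp add: scaleR_2[symmetric])
      then show ?case using elim t by (auto simp: D_def)
    qed
    have nn: "(\<integral>\<^sup>+x. exp (g x) \<partial>M) = ennreal (\<integral>x. exp (g x) \<partial>M)" if "continuous_on UNIV g" for g :: "'a \<Rightarrow> real"
      using that by (intro nn_integral_eq_integral integrable_of_continuous[where R=R] sets_M R continuous_intros)
        (auto simp: finite_measure_axioms)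
    have cc: "continuous_on UNIV (\<lambda>x. \<Phi> x + b x - D x / 2)" "continuous_on UNIV (\<lambda>x. \<Phi> x - b x - D x / 2)"
      by (auto intro!: continuous_intros)
    have "(\<integral>\<^sup>+x. exp (\<Phi> x + b x - D x / 2) \<partial>M) * (\<integral>\<^sup>+x. exp (\<Phi> x - b x - D x / 2) \<partial>M)
      \<le> ennreal (exp (2 * \<delta>)) * (\<integral>\<^sup>+x. exp (\<Phi> x) \<partial>M)\<^sup>2"
    proof (rule log_concave_prekopa_leindler[OF lc])
      show "convex (cball 0 R :: 'a set)" "closed (cball 0 R :: 'a set)" by auto
      show "AE x in M. x \<in> cball 0 R" using R(1) by simp
      fix x y :: 'a assume xy: "x \<in> cball 0 R" "y \<in> cball 0 R"
      let ?z = "(1/2) *\<^sub>R (x + y)"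
      \<comment> \<open>The quadratic term of \<open>\<Phi>\<close> yields, through this identity,
        exactly the \<open>C\<^sub>1 * (norm (x - y))\<^sup>2\<close> lost in the midpoint
        inequality.\<close>
      have par: "(norm x)\<^sup>2 + (norm y)\<^sup>2 = 2 * (norm ?z)\<^sup>2 + (norm (x - y))\<^sup>2 / 2"
        unfolding power2_norm_eq_inner by (simp add: inner_simps inner_commute field_simps)
      have "f0 x + f1 y \<le> 2 * f ?z + C\<^sub>1 * norm (x - y) powr q" using mid xy by auto
      also have "\<dots> \<le> 2 * f ?z + C\<^sub>1 * (\<epsilon> powr (q - 2) * (norm (x - y))\<^sup>2 + \<epsilon> powr q)"
        using \<open>0 < C\<^sub>1\<close> \<epsilon> q by (intro add_left_mono mult_left_mono powr_le_square_plus) auto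
      finally have "t * (f0 x + f1 y) \<le> t * (2 * f ?z + C\<^sub>1 * (\<epsilon> powr (q - 2) * (norm (x - y))\<^sup>2 + \<epsilon> powr q))"
        using t by (intro mult_left_mono) auto
      also have "\<dots> = 2 * (t * f ?z) + C\<^sub>1 * ((t * \<epsilon> powr (q - 2)) * (norm (x - y))\<^sup>2 + t * \<epsilon> powr q)"
        by (simp add: algebra_simps)
      also have "\<dots> = 2 * (t * f ?z) + C\<^sub>1 * (norm (x - y))\<^sup>2 + 2 * \<delta>"
        unfolding te by (simp add: \<delta>_def algebra_simps)
      finally have *: "t * (f0 x + f1 y) \<le> 2 * (t * f ?z) + C\<^sub>1 * (norm (x - y))\<^sup>2 + 2 * \<delta>" .
      have "(\<Phi> x + b x - D x / 2) + (\<Phi> y - b y - D y / 2)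
        = t * (f0 x + f1 y) - 2 * (t * f 0) - 2 * C\<^sub>1 * ((norm x)\<^sup>2 + (norm y)\<^sup>2)"
        by (simp add: \<Phi>_def b_def D_def k_def field_simps)
      also have "\<dots> \<le> 2 * \<Phi> ?z + 2 * \<delta>"
        unfolding par using * by (simp add: \<Phi>_def algebra_simps)
      finally show "(\<Phi> x + b x - D x / 2) + (\<Phi> y - b y - D y / 2) \<le> 2 * \<Phi> ?z + 2 * \<delta>" .
    qed measurable
    then have laplace: "(\<integral>x. exp (\<Phi> x + b x - D x / 2) \<partial>M) * (\<integral>x. exp (\<Phi> x - b x - D x / 2) \<partial>M)
      \<le> exp (2 * \<delta>) * (\<integral>x. exp (\<Phi> x) \<partial>M)\<^sup>2"
      unfolding nn[OF c\<Phi>] nn[OF cc(1)] nn[OF cc(2)] by (simp add: ennreal_mult'[symmetric] ennreal_power)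
    have "0 \<le> \<delta>" using \<open>0 < C\<^sub>1\<close> by (simp add: \<delta>_def)
    from variance_le_of_laplace_product[OF _ _ _ \<Phi>S bB DT this laplace]
    obtain m where m: "(\<integral>x. (b x - m)\<^sup>2 \<partial>M)
      \<le> exp (4 * B + 2 * S) * (\<integral>x. D x \<partial>M) + 2 * exp (2 * B + 2 * S) * (exp \<delta> - 1)" by auto
    \<comment> \<open>The centring constant of \<open>b\<close> translated back to
      \<open>f0 - f1\<close>.\<close>
    define m' where "m' = 2 * (k 0 + m / t)"
    define I where "I = (\<integral>x. 2 * f x - f0 x - f1 x \<partial>M)"
    have DI: "(\<integral>x. D x \<partial>M) = t * I" unfolding D_def I_def by simp
    have "AE x in M. 0 \<le> D x" using DT by auto
    then have "0 \<le> (\<integral>x. D x \<partial>M)" by (rule integral_nonneg_AE)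
    then have I0: "0 \<le> I" unfolding DI using t by (simp add: zero_le_mult_iff)
    have "exp \<delta> - 1 \<le> \<delta> * exp \<delta>"
    proof -
      have "exp \<delta> * (1 + - \<delta>) \<le> exp \<delta> * exp (- \<delta>)" by (intro mult_left_mono exp_ge_add_one_self) auto
      moreover have "exp \<delta> * exp (- \<delta>) = 1" by (simp flip: exp_add)
      ultimately show ?thesis by (simp add: algebra_simps)
    qed
    also have "\<dots> \<le> \<delta> * exp (C\<^sub>1 * E\<^sup>2 / 2)"
      using \<epsilon> \<open>0 < C\<^sub>1\<close> \<open>0 \<le> \<delta>\<close> unfolding \<delta>_def by (intro mult_left_mono) (auto intro!: mult_left_mono divide_right_mono power_mono)
    finally have e: "exp \<delta> - 1 \<le> C\<^sub>1 * \<epsilon>\<^sup>2 / 2 * exp (C\<^sub>1 * E\<^sup>2 / 2)" by (simp add: \<delta>_def)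
    have "(\<integral>x. (f0 x - f1 x - m')\<^sup>2 \<partial>M) = (\<integral>x. (4 / t\<^sup>2) * (b x - m)\<^sup>2 \<partial>M)"
    proof (rule Bochner_Integration.integral_cong)
      fix x
      have "f0 x - f1 x - m' = 2 / t * (b x - m)" using t by (simp add: b_def m'_def k_def field_simps)
      then show "(f0 x - f1 x - m')\<^sup>2 = (4 / t\<^sup>2) * (b x - m)\<^sup>2"
        by (simp only: power_mult_distrib power_divide) simp
    qed simp
    also have "\<dots> = (4 / t\<^sup>2) * (\<integral>x. (b x - m)\<^sup>2 \<partial>M)" by simp
    also have "\<dots> \<le> (4 / t\<^sup>2) * (exp (4 * B + 2 * S) * (t * I) + 2 * exp (2 * B + 2 * S) * (C\<^sub>1 * \<epsilon>\<^sup>2 / 2 * exp (C\<^sub>1 * E\<^sup>2 / 2)))"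
      using m e unfolding DI by (intro mult_left_mono) (auto intro!: order_trans[OF m[unfolded DI]] mult_left_mono)
    \<comment> \<open>The gap carries one factor \<open>t\<close>, so \<open>1 / t\<close> survives;
      the error term carries none and keeps the full \<open>1 / t\<^sup>2\<close>.\<close>
    also have "\<dots> = K\<^sub>1 * ((1 / t) * I) + K\<^sub>2 * (\<epsilon>\<^sup>2 / t\<^sup>2)"
      using t by (simp add: K\<^sub>1_def K\<^sub>2_def power2_eq_square field_simps)
    also have "\<dots> \<le> C * ((1 / t) * I) + C * (\<epsilon>\<^sup>2 / t\<^sup>2)"
      using t I0 by (intro add_mono mult_right_mono) (auto simp: C_def)
    also have "\<dots> = C * (\<epsilon> powr (q - 2) * I + \<epsilon> powr (2 * q - 2))"
      unfolding te te' by (simp add: algebra_simps)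
    finally show "\<exists>m. (\<integral>x. (f0 x - f1 x - m)\<^sup>2 \<partial>M)
      \<le> C * (\<epsilon> powr (q - 2) * (\<integral>x. 2 * f x - f0 x - f1 x \<partial>M) + \<epsilon> powr (2 * q - 2))"
      unfolding I_def by blast
  qed
qed

section \<open>Wasserstein distance and Lipschitz potentials\<close>

text \<open>The complement of the support is covered by null open sets, hence, by second
  countability, by countably many null basic ones.\<close>

lemma AE_in_measure_support:
  fixes M :: "'a::second_countable_topology measure"
  assumes "sets M = sets borel"
  shows "AE x in M. x \<in> measure_support M"
proof -
  obtain B :: "'a set set" where B: "countable B" "topological_basis B"
    using ex_countable_basis by blast
  define N where "N = {U \<in> B. emeasure M U = 0}"
  have "(\<Union>U\<in>N. U) \<in> null_sets M"
  proof (rule null_sets_UN')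
    show "countable N" using B(1) by (auto simp: N_def intro: countable_subset)
    show "U \<in> null_sets M" if "U \<in> N" for U
      using that topological_basis_open[OF B(2)] assms by (auto simp: N_def null_sets_def)
  qed
  moreover have "{x \<in> space M. x \<notin> measure_support M} \<subseteq> (\<Union>U\<in>N. U)"
  proof
    fix x assume "x \<in> {x \<in> space M. x \<notin> measure_support M}"
    then obtain U where U: "open U" "x \<in> U" "emeasure M U = 0"
      by (auto simp: measure_support_def)
    then obtain V where V: "V \<in> B" "x \<in> V" "V \<subseteq> U" using topological_basisE[OF B(2)] by metis
    have "emeasure M V \<le> emeasure M U" using U V assms by (intro emeasure_mono) auto
    then show "x \<in> (\<Union>U\<in>N. U)" using U V by (auto simp: N_def)
  qed
  ultimately show ?thesis by (rule AE_I')
qed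

lemma AE_norm_le_coupling:
  assumes "\<pi> \<in> couplings \<mu> \<nu>"
  shows "AE x in \<mu>. norm x \<le> R \<Longrightarrow> AE z in \<pi>. norm (fst z) \<le> R"
    and "AE x in \<nu>. norm x \<le> R \<Longrightarrow> AE z in \<pi>. norm (snd z) \<le> R"
proof -
  have s [measurable_cong]: "sets \<pi> = sets (borel \<Otimes>\<^sub>M borel)"
    using assms(1) unfolding couplings_def borel_prob_def borel_prod by simp
  have d: "distr \<pi> borel fst = \<mu>" "distr \<pi> borel snd = \<nu>"
    using assms(1) by (auto simp: couplings_def)
  show "AE x in \<mu>. norm x \<le> R \<Longrightarrow> AE z in \<pi>. norm (fst z) \<le> R"
    unfolding d[symmetric] by (subst (asm) AE_distr_iff) auto
  show "AE x in \<nu>. norm x \<le> R \<Longrightarrow> AE z in \<pi>. norm (snd z) \<le> R"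
    unfolding d[symmetric] by (subst (asm) AE_distr_iff) auto
qed

text \<open>Guarantees that the infimum in \<open>wasserstein\<close> is over a nonempty
  set.\<close>

lemma pair_measure_in_couplings:
  assumes "borel_prob \<mu>" "borel_prob \<nu>"
  shows "\<mu> \<Otimes>\<^sub>M \<nu> \<in> couplings \<mu> \<nu>"
proof -
  interpret \<mu>: prob_space \<mu> using assms by (simp add: borel_prob_def)
  interpret \<nu>: prob_space \<nu> using assms by (simp add: borel_prob_def)
  interpret P: pair_prob_space \<mu> \<nu> ..
  have s: "sets \<mu> = sets borel" "sets \<nu> = sets borel" using assms by (auto simp: borel_prob_def)
  have "sets (\<mu> \<Otimes>\<^sub>M \<nu>) = sets borel" using sets_pair_measure_cong[OF s] unfolding borel_prod .
  moreover have "distr (\<mu> \<Otimes>\<^sub>M \<nu>) borel fst = \<mu>"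
    using \<nu>.distr_pair_fst[of \<mu>] distr_cong[OF refl s(1), of "\<mu> \<Otimes>\<^sub>M \<nu>" fst fst] by simp
  moreover have "distr (\<mu> \<Otimes>\<^sub>M \<nu>) borel snd = \<nu>"
  proof (rule measure_eqI)
    fix A assume "A \<in> sets (distr (\<mu> \<Otimes>\<^sub>M \<nu>) borel snd)"
    then have A: "A \<in> sets \<nu>" by (simp add: s)
    have [simp]: "space \<mu> = UNIV" "space \<nu> = UNIV" using s[THEN sets_eq_imp_space_eq] by simp_all
    have snd: "snd \<in> \<mu> \<Otimes>\<^sub>M \<nu> \<rightarrow>\<^sub>M borel"
      using measurable_snd[of \<mu> \<nu>] measurable_cong_sets[OF refl s(2)] by blast
    have "emeasure (distr (\<mu> \<Otimes>\<^sub>M \<nu>) borel snd) A = emeasure (\<mu> \<Otimes>\<^sub>M \<nu>) (UNIV \<times> A)"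
      using A s snd by (subst emeasure_distr) (auto simp: space_pair_measure intro!: arg_cong2[where f=emeasure])
    also have "\<dots> = emeasure \<nu> A"
      using A \<mu>.emeasure_space_1 s by (subst \<nu>.emeasure_pair_measure_Times) auto
    finally show "emeasure (distr (\<mu> \<Otimes>\<^sub>M \<nu>) borel snd) A = emeasure \<nu> A" .
  qed (simp add: s)
  ultimately show ?thesis
    by (simp add: couplings_def borel_prob_def P.prob_space_axioms)
qed

lemma wasserstein_one:
  "wasserstein 1 \<mu> \<nu> = (INF \<pi>\<in>couplings \<mu> \<nu>. \<integral>z. norm (snd z - fst z) \<partial>\<pi>)"
  unfolding wasserstein_def by (intro INF_cong) (simp_all add: powr_one')

lemma wasserstein_nonneg:
  assumes "borel_prob \<mu>" "borel_prob \<nu>"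
  shows "0 \<le> wasserstein p \<mu> \<nu>"
  unfolding wasserstein_def using pair_measure_in_couplings[OF assms] by (intro cINF_greatest) auto

lemma integrable_coupling:
  fixes u :: "'a::euclidean_space \<times> 'a \<Rightarrow> real"
  assumes "\<pi> \<in> couplings \<mu> \<nu>" and AE: "AE x in \<mu>. norm x \<le> R" "AE x in \<nu>. norm x \<le> R"
    and "continuous_on UNIV u"
  shows "integrable \<pi> u"
proof (rule integrable_of_continuous)
  show "finite_measure \<pi>" "sets \<pi> = sets borel"
    using assms(1) by (auto simp: couplings_def borel_prob_def prob_space_def)
  show "AE z in \<pi>. norm z \<le> R + R"
    using AE_norm_le_coupling(1)[OF assms(1) AE(1)] AE_norm_le_coupling(2)[OF assms(1) AE(2)]
  proof eventually_elim
    case (elim z)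
    then show ?case using norm_Pair_le[of "fst z" "snd z"] by simp
  qed
qed fact

text \<open>The easy half of Kantorovich-Rubinstein duality: integrate
  \<open>g (fst z) - g (snd z)\<close> against an arbitrary coupling.\<close>

lemma lipschitz_integral_diff_le_wasserstein:
  fixes g :: "'a::euclidean_space \<Rightarrow> real"
  assumes \<mu>\<nu>: "borel_prob \<mu>" "borel_prob \<nu>"
    and AE: "AE x in \<mu>. norm x \<le> R" "AE x in \<nu>. norm x \<le> R"
    and g: "L-lipschitz_on UNIV g"
  shows "(\<integral>x. g x \<partial>\<mu>) - (\<integral>x. g x \<partial>\<nu>) \<le> L * wasserstein 1 \<mu> \<nu>"
proof -
  have L0: "0 \<le> L" using g by (rule lipschitz_on_nonneg)
  have cg: "continuous_on UNIV g" using g by (rule lipschitz_on_continuous_on)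
  then have [measurable]: "g \<in> borel_measurable borel" by (rule borel_measurable_continuous_onI)
  have le: "(\<integral>x. g x \<partial>\<mu>) - (\<integral>x. g x \<partial>\<nu>) \<le> L * (\<integral>z. norm (snd z - fst z) \<partial>\<pi>)"
    if \<pi>: "\<pi> \<in> couplings \<mu> \<nu>" for \<pi>
  proof -
    have [measurable_cong]: "sets \<pi> = sets (borel \<Otimes>\<^sub>M borel)"
      using \<pi> unfolding couplings_def borel_prob_def borel_prod by simp
    have d: "distr \<pi> borel fst = \<mu>" "distr \<pi> borel snd = \<nu>" using \<pi> by (auto simp: couplings_def)
    note int = integrable_coupling[OF \<pi> AE]
    have cf: "continuous_on UNIV (\<lambda>z. g (fst z))" "continuous_on UNIV (\<lambda>z. g (snd z))"
      by (auto intro!: continuous_on_compose2[OF cg] continuous_intros)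
    have "(\<integral>x. g x \<partial>\<mu>) - (\<integral>x. g x \<partial>\<nu>) = (\<integral>z. g (fst z) \<partial>\<pi>) - (\<integral>z. g (snd z) \<partial>\<pi>)"
      unfolding d[symmetric] by (simp add: integral_distr)
    also have "\<dots> = (\<integral>z. g (fst z) - g (snd z) \<partial>\<pi>)"
      by (rule Bochner_Integration.integral_diff[OF int[OF cf(1)] int[OF cf(2)], symmetric])
    also have "\<dots> \<le> (\<integral>z. L * norm (snd z - fst z) \<partial>\<pi>)"
    proof (rule integral_mono)
      show "integrable \<pi> (\<lambda>z. g (fst z) - g (snd z))"
        by (rule Bochner_Integration.integrable_diff[OF int[OF cf(1)] int[OF cf(2)]])
      show "integrable \<pi> (\<lambda>z. L * norm (snd z - fst z))" by (intro int continuous_intros)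
      show "g (fst z) - g (snd z) \<le> L * norm (snd z - fst z)" for z
        using lipschitz_onD[OF g, of "fst z" "snd z"] by (simp add: dist_real_def dist_norm norm_minus_commute)
    qed
    finally show ?thesis by simp
  qed
  show ?thesis
  \<comment> \<open>Passing to the infimum over couplings divides by \<open>L\<close>.\<close>
  proof (cases "L = 0")
    case True
    then show ?thesis using le[OF pair_measure_in_couplings[OF \<mu>\<nu>]] by simp
  next
    case False
    then have "((\<integral>x. g x \<partial>\<mu>) - (\<integral>x. g x \<partial>\<nu>)) / L \<le> wasserstein 1 \<mu> \<nu>"
      unfolding wasserstein_one using pair_measure_in_couplings[OF \<mu>\<nu>] le L0
      by (intro cINF_greatest) (auto simp: field_simps)
    then show ?thesis using False L0 by (simp add: field_simps)
  qed
qed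

text \<open>The product coupling is the competitor. The bound confines the scale
  \<open>\<epsilon>\<close> to a fixed range, as uniform constants require.\<close>

lemma wasserstein_one_le_diameter:
  fixes \<mu> \<nu> :: "'a::euclidean_space measure"
  assumes \<mu>\<nu>: "borel_prob \<mu>" "borel_prob \<nu>"
    and AE: "AE x in \<mu>. norm x \<le> R" "AE x in \<nu>. norm x \<le> R"
  shows "wasserstein 1 \<mu> \<nu> \<le> 2 * R"
proof -
  let ?P = "\<mu> \<Otimes>\<^sub>M \<nu>"
  note \<pi> = pair_measure_in_couplings[OF \<mu>\<nu>]
  interpret P: prob_space ?P using \<pi> by (simp add: couplings_def borel_prob_def)
  have "wasserstein 1 \<mu> \<nu> \<le> (\<integral>z. norm (snd z - fst z) \<partial>?P)"
    unfolding wasserstein_one by (rule cINF_lower[OF _ \<pi>]) (auto intro!: bdd_belowI[of _ 0])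
  also have "\<dots> \<le> (\<integral>z. 2 * R \<partial>?P)"
  proof (rule integral_mono_AE)
    show "integrable ?P (\<lambda>z. norm (snd z - fst z))"
      by (intro integrable_coupling[OF \<pi> AE] continuous_intros)
    show "AE z in ?P. norm (snd z - fst z) \<le> 2 * R"
      using AE_norm_le_coupling(1)[OF \<pi> AE(1)] AE_norm_le_coupling(2)[OF \<pi> AE(2)]
    proof eventually_elim
      case (elim z)
      then show ?case using norm_triangle_ineq4[of "snd z" "fst z"] by simp
    qed
  qed simp
  finally show ?thesis by (simp add: P.prob_space)
qed

section \<open>The c-transform on a compact convex set and Lipschitz optimal pairs\<close>

text \<open>\<open>X\<close> will be a closed ball carrying all measures involved. Convexity serves
  twice: the closest-point projection is nonexpansive, and midpoints stay in
  \<open>X\<close>.\<close>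

locale power_cost =
  fixes p L :: real and X :: "'a::euclidean_space set"
  assumes compact: "compact X" and convex: "convex X" and nonempty: "X \<noteq> {}" and L_nonneg: "0 \<le> L"
    and cost_lipschitz: "\<lbrakk>x \<in> X; x' \<in> X; y \<in> X\<rbrakk> \<Longrightarrow>
      norm (x - y) powr p \<le> norm (x' - y) powr p + L * norm (x - x')"
begin

text \<open>Projecting the argument to \<open>X\<close> makes the transform Lipschitz on the whole space.\<close>

definition c_transform :: "'a set \<Rightarrow> ('a \<Rightarrow> real) \<Rightarrow> 'a \<Rightarrow> real" where
  "c_transform S g x = (INF y\<in>S. norm (closest_point X x - y) powr p - g y)"

lemma closest_point_X: "closest_point X x \<in> X"
  using compact nonempty by (simp add: closest_point_in_set compact_imp_closed)

lemma closest_point_id: "x \<in> X \<Longrightarrow> closest_point X x = x"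
  by (rule closest_point_self)

lemma bdd_below_transform:
  assumes "bdd_above (g ` S)"
  shows "bdd_below ((\<lambda>y. norm (z - y) powr p - g y) ` S)"
proof -
  obtain K where "\<And>y. y \<in> S \<Longrightarrow> g y \<le> K" using assms by (auto simp: bdd_above_def)
  then show ?thesis by (intro bdd_belowI2[of _ "- K"]) (smt (verit) powr_ge_zero)
qed

lemma c_transform_le:
  assumes "bdd_above (g ` S)" "x \<in> X" "y \<in> S"
  shows "c_transform S g x \<le> norm (x - y) powr p - g y"
  unfolding c_transform_def closest_point_id[OF assms(2)]
  by (rule cINF_lower[OF bdd_below_transform[OF assms(1)] assms(3)])

lemma c_transform_ge:
  assumes "S \<noteq> {}" "x \<in> X" "\<And>y. y \<in> S \<Longrightarrow> k \<le> norm (x - y) powr p - g y"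
  shows "k \<le> c_transform S g x"
  unfolding c_transform_def closest_point_id[OF assms(2)]
  using assms by (intro cINF_greatest) auto

lemma c_transform_lipschitz:
  assumes "bdd_above (g ` S)" "S \<noteq> {}" "S \<subseteq> X"
  shows "L-lipschitz_on UNIV (c_transform S g)"
proof -
  have le: "c_transform S g x - L * norm (x - x') \<le> c_transform S g x'" for x x'
    unfolding c_transform_def[of S g x']
  proof (rule cINF_greatest)
    fix y assume y: "y \<in> S"
    let ?P = "closest_point X"
    have "c_transform S g x \<le> norm (?P x - y) powr p - g y"
      unfolding c_transform_def by (rule cINF_lower[OF bdd_below_transform[OF assms(1)] y])
    also have "norm (?P x - y) powr p \<le> norm (?P x' - y) powr p + L * norm (?P x - ?P x')"
      using y assms(3) by (intro cost_lipschitz closest_point_X) auto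
    also have "norm (?P x - ?P x') \<le> norm (x - x')"
      using closest_point_lipschitz[OF convex compact_imp_closed[OF compact] nonempty, of x x']
      by (simp add: dist_norm)
    finally show "c_transform S g x - L * norm (x - x') \<le> norm (?P x' - y) powr p - g y"
      using L_nonneg by (auto simp: mult_left_mono)
  qed fact
  show ?thesis
  proof (rule lipschitz_onI)
    fix x x' :: 'a
    show "dist (c_transform S g x) (c_transform S g x') \<le> L * dist x x'"
      using le[of x x'] le[of x' x] by (simp add: dist_norm norm_minus_commute abs_le_iff)
  qed (rule L_nonneg)
qed

lemma bdd_above_lipschitz_image:
  fixes f :: "'a \<Rightarrow> real"
  assumes "K-lipschitz_on UNIV f"
  shows "bdd_above (f ` X)"
  using assms compact
  by (intro bounded_imp_bdd_above compact_imp_bounded compact_continuous_image)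
     (auto intro: lipschitz_on_continuous_on continuous_on_subset)

lemma X_cball: "\<exists>R. X \<subseteq> cball 0 R"
  using compact_imp_bounded[OF compact] by (auto simp: bounded_iff subset_iff)

text \<open>The value \<open>-\<infinity>\<close> outside \<open>X\<close> makes the dual constraint
  void there, and closedness of \<open>X\<close> keeps upper semicontinuity. Real functions
  constrained only on \<open>X\<close> thus become dual competitors with unchanged
  integrals.\<close>

lemma truncated_potential:
  fixes u :: "'a \<Rightarrow> real"
  assumes \<rho>: "prob_space \<rho>" "sets \<rho> = sets borel" "AE x in \<rho>. x \<in> X" and u: "continuous_on UNIV u"
  defines "\<phi> \<equiv> \<lambda>x. if x \<in> X then ereal (u x) else - \<infinity>"
  shows "upper_semicontinuous \<phi>" "ereal_integrable \<rho> \<phi>" "ereal_integral \<rho> \<phi> = (\<integral>x. u x \<partial>\<rho>)" "integrable \<rho> u"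
proof -
  interpret prob_space \<rho> by fact
  note [measurable_cong] = \<rho>(2)
  have cl: "closed X" using compact by (rule compact_imp_closed)
  have [measurable]: "X \<in> sets borel" "u \<in> borel_measurable borel"
    using cl u by (auto intro: borel_measurable_continuous_onI)
  show "upper_semicontinuous \<phi>"
    unfolding upper_semicontinuous_def
  proof
    fix a :: ereal
    have "{x. \<phi> x < a} = (if a = -\<infinity> then {} else - X \<union> {x. ereal (u x) < a})"
      by (auto simp: \<phi>_def less_le)
    moreover have "open {x. ereal (u x) < a}"
      using u by (intro open_Collect_less continuous_intros)
    ultimately show "open {x. \<phi> x < a}" using cl by auto
  qed
  have ae: "AE x in \<rho>. real_of_ereal (\<phi> x) = u x" using \<rho>(3) by (auto simp: \<phi>_def)
  have [measurable]: "(\<lambda>x. real_of_ereal (\<phi> x)) \<in> borel_measurable \<rho>" unfolding \<phi>_def by measurable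
  obtain R where "X \<subseteq> cball 0 R" using X_cball by blast
  then have "AE x in \<rho>. norm x \<le> R" using \<rho>(3) by (auto simp: subset_iff)
  then show int: "integrable \<rho> u"
    using u \<rho>(2) by (intro integrable_of_continuous) (auto simp: finite_measure_axioms)
  show "ereal_integral \<rho> \<phi> = (\<integral>x. u x \<partial>\<rho>)"
    unfolding ereal_integral_def using ae by (intro integral_cong_AE) auto
  show "ereal_integrable \<rho> \<phi>"
    unfolding ereal_integrable_def
  proof
    show "AE x in \<rho>. \<bar>\<phi> x\<bar> \<noteq> \<infinity>" using \<rho>(3) by (auto simp: \<phi>_def)
    show "integrable \<rho> (\<lambda>x. real_of_ereal (\<phi> x))"
      using int ae by (subst integrable_cong_AE[of _ _ u]) auto
  qed
qed

lemma dual_value_le: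
  fixes u v :: "'a \<Rightarrow> real"
  assumes \<rho>: "prob_space \<rho>" "sets \<rho> = sets borel" "AE x in \<rho>. x \<in> X"
    and \<mu>: "prob_space \<mu>" "sets \<mu> = sets borel" "AE x in \<mu>. x \<in> X"
    and opt: "kantorovich_potentials p \<rho> \<mu> \<phi> \<psi>"
    and uv: "continuous_on UNIV u" "continuous_on UNIV v"
      "\<And>x y. x \<in> X \<Longrightarrow> y \<in> X \<Longrightarrow> u x + v y \<le> norm (x - y) powr p"
  shows "(\<integral>x. u x \<partial>\<rho>) + (\<integral>y. v y \<partial>\<mu>) \<le> ereal_integral \<rho> \<phi> + ereal_integral \<mu> \<psi>"
proof -
  let ?u = "\<lambda>x. if x \<in> X then ereal (u x) else - \<infinity>"
  let ?v = "\<lambda>x. if x \<in> X then ereal (v x) else - \<infinity>"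
  note tu = truncated_potential[OF \<rho> uv(1)] and tv = truncated_potential[OF \<mu> uv(2)]
  have "admissible_pair p \<rho> \<mu> ?u ?v"
    unfolding admissible_pair_def using tu tv uv(3) by auto
  then have "ereal_integral \<rho> ?u + ereal_integral \<mu> ?v \<le> ereal_integral \<rho> \<phi> + ereal_integral \<mu> \<psi>"
    using opt by (auto simp: kantorovich_potentials_def)
  then show ?thesis using tu tv by simp
qed

text \<open>Transforming twice can only raise both potentials and keeps the constraint, so
  optimality forces equal integrals; as \<open>\<phi> \<le> f\<close> on \<open>X\<close>, it also
  forces equality almost everywhere.\<close>

lemma lipschitz_potentials:
  assumes \<rho>: "prob_space \<rho>" "sets \<rho> = sets borel" "AE x in \<rho>. x \<in> X"
    and \<mu>: "prob_space \<mu>" "sets \<mu> = sets borel" "AE x in \<mu>. x \<in> X"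
    and opt: "kantorovich_potentials p \<rho> \<mu> \<phi> \<psi>"
  obtains f g where "L-lipschitz_on UNIV f" "L-lipschitz_on UNIV g"
    "\<And>x y. x \<in> X \<Longrightarrow> y \<in> X \<Longrightarrow> f x + g y \<le> norm (x - y) powr p"
    "AE x in \<rho>. real_of_ereal (\<phi> x) = f x"
    "(\<integral>x. f x \<partial>\<rho>) + (\<integral>y. g y \<partial>\<mu>) = ereal_integral \<rho> \<phi> + ereal_integral \<mu> \<psi>"
proof -
  interpret \<rho>: prob_space \<rho> by fact
  interpret \<mu>: prob_space \<mu> by fact
  have adm: "\<And>x. \<phi> x \<noteq> \<infinity>" "\<And>y. \<psi> y \<noteq> \<infinity>" "\<And>x y. \<phi> x + \<psi> y \<le> ereal (norm (x - y) powr p)"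
      "AE x in \<rho>. \<bar>\<phi> x\<bar> \<noteq> \<infinity>" "integrable \<rho> (\<lambda>x. real_of_ereal (\<phi> x))"
      "AE y in \<mu>. \<bar>\<psi> y\<bar> \<noteq> \<infinity>" "integrable \<mu> (\<lambda>y. real_of_ereal (\<psi> y))"
    using opt by (auto simp: kantorovich_potentials_def admissible_pair_def ereal_integrable_def)
  have ex: "\<exists>x. P x" if "prob_space M" "AE x in M. P x" for M :: "'a measure" and P
  proof (rule ccontr)
    assume "\<not> (\<exists>x. P x)"
    then have "AE x in M. False" using that(2) by simp
    then show False using prob_space.AE_False[OF that(1)] by blast
  qed
  \<comment> \<open>The transform acts on real functions, so points with
    \<open>\<psi> = -\<infinity>\<close> are discarded; \<open>S\<close> still has full
    measure.\<close>
  define S where "S = {y \<in> X. \<bar>\<psi> y\<bar> \<noteq> \<infinity>}"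
  define h where "h y = real_of_ereal (\<psi> y)" for y
  have AE_S: "AE y in \<mu>. y \<in> S" using \<mu>(3) adm(6) by (auto simp: S_def)
  have S: "S \<noteq> {}" "S \<subseteq> X" using ex[OF \<mu>(1) AE_S] by (auto simp: S_def)
  have h: "\<psi> y = ereal (h y)" if "y \<in> S" for y using that by (auto simp: S_def h_def ereal_real)
  have "AE x in \<rho>. x \<in> X \<and> \<bar>\<phi> x\<bar> \<noteq> \<infinity>" using \<rho>(3) adm(4) by auto
  \<comment> \<open>One point with finite \<open>\<phi>\<close> bounds \<open>h\<close> from above
    on \<open>S\<close>, so that the infimum in the transform is bounded below.\<close>
  from ex[OF \<rho>(1) this] obtain x0 where x0: "x0 \<in> X" "\<bar>\<phi> x0\<bar> \<noteq> \<infinity>" by (elim exE conjE)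
  obtain r0 where r0: "\<phi> x0 = ereal r0" using x0(2) by (cases "\<phi> x0") auto
  obtain R where R: "X \<subseteq> cball 0 R" using X_cball by blast
  define K where "K = L * (R + R)"
  have K: "norm (x0 - y) powr p \<le> K" if "y \<in> X" for y
  proof -
    have "norm (y - x0) \<le> R + R"
    proof -
      have "norm y \<le> R" "norm x0 \<le> R" using R that x0(1) by auto
      then show ?thesis using norm_triangle_ineq4[of y x0] by linarith
    qed
    then have "L * norm (y - x0) \<le> K" unfolding K_def using L_nonneg by (intro mult_left_mono)
    then show ?thesis using cost_lipschitz[OF that x0(1) x0(1)] by (simp add: norm_minus_commute)
  qed
  have bddh: "bdd_above (h ` S)"
  proof (rule bdd_aboveI2)
    fix y assume y: "y \<in> S"
    have "ereal (r0 + h y) \<le> ereal (norm (x0 - y) powr p)" using adm(3)[of x0 y] by (simp add: r0 h[OF y])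
    then show "h y \<le> K - r0" using K[of y] y S by auto
  qed
  define f where "f = c_transform S h"
  define g where "g = c_transform X f"
  have lf: "L-lipschitz_on UNIV f" unfolding f_def by (rule c_transform_lipschitz[OF bddh S])
  have bddf: "bdd_above (f ` X)" by (rule bdd_above_lipschitz_image[OF lf])
  have lg: "L-lipschitz_on UNIV g" unfolding g_def by (rule c_transform_lipschitz[OF bddf nonempty order_refl])
  have fg: "f x + g y \<le> norm (x - y) powr p" if "x \<in> X" "y \<in> X" for x y
    using c_transform_le[OF bddf that(2,1)] by (simp add: g_def norm_minus_commute)
  have \<phi>f: "\<phi> x \<le> ereal (f x)" if "x \<in> X" for x
  proof (cases "\<phi> x")
    case (real r)
    have "r \<le> norm (x - y) powr p - h y" if "y \<in> S" for y
    proof -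
      have "ereal (r + h y) \<le> ereal (norm (x - y) powr p)" using adm(3)[of x y] by (simp add: real h[OF that])
      then show ?thesis by simp
    qed
    then have "r \<le> f x" unfolding f_def by (rule c_transform_ge[OF S(1) \<open>x \<in> X\<close>])
    then show ?thesis using real by simp
  qed (use adm in auto)
  have \<psi>g: "h y \<le> g y" if "y \<in> S" for y
    unfolding g_def
  proof (rule c_transform_ge[OF nonempty])
    show "y \<in> X" using that S by auto
    fix x assume "x \<in> X"
    then show "h y \<le> norm (y - x) powr p - f x"
      using c_transform_le[OF bddh _ that, of x] by (simp add: f_def norm_minus_commute)
  qed
  have cfg: "continuous_on UNIV f" "continuous_on UNIV g" using lf lg by (auto intro: lipschitz_on_continuous_on)
  note intf = truncated_potential(4)[OF \<rho> cfg(1)] and intg = truncated_potential(4)[OF \<mu> cfg(2)]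
  have leAE: "AE x in \<rho>. real_of_ereal (\<phi> x) \<le> f x"
    using \<rho>(3) adm(4)
  proof eventually_elim
    case (elim x)
    then obtain r where "\<phi> x = ereal r" by (cases "\<phi> x") auto
    then show ?case using \<phi>f[of x] elim by simp
  qed
  then have le1: "ereal_integral \<rho> \<phi> \<le> (\<integral>x. f x \<partial>\<rho>)"
    unfolding ereal_integral_def using intf adm(5) by (intro integral_mono_AE)
  have "AE y in \<mu>. h y \<le> g y" using AE_S \<psi>g by auto
  then have le2: "ereal_integral \<mu> \<psi> \<le> (\<integral>y. g y \<partial>\<mu>)"
    unfolding ereal_integral_def h_def using intg adm(7) by (intro integral_mono_AE)
  have "(\<integral>x. f x \<partial>\<rho>) + (\<integral>y. g y \<partial>\<mu>) \<le> ereal_integral \<rho> \<phi> + ereal_integral \<mu> \<psi>"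
    by (rule dual_value_le[OF \<rho> \<mu> opt cfg fg])
  then have eq: "ereal_integral \<rho> \<phi> = (\<integral>x. f x \<partial>\<rho>)" "ereal_integral \<mu> \<psi> = (\<integral>y. g y \<partial>\<mu>)"
    using le1 le2 by auto
  have "(\<integral>x. f x - real_of_ereal (\<phi> x) \<partial>\<rho>) = 0"
    using eq(1) intf adm(5) by (simp add: ereal_integral_def)
  then have "AE x in \<rho>. f x - real_of_ereal (\<phi> x) = 0"
    using leAE intf adm(5) by (subst (asm) integral_nonneg_eq_0_iff_AE) auto
  then have "AE x in \<rho>. real_of_ereal (\<phi> x) = f x" by auto
  then show ?thesis using that[OF lf lg fg] eq by simp
qed

end

section \<open>Stability of the potentials\<close>

context power_cost
begin

text \<open>For each \<open>y\<close>, add the constraints at \<open>(x, y)\<close> and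
  \<open>(x', y)\<close>. Semiconcavity moves both costs to the midpoint at a price independent of
  \<open>y\<close>, so the infimum over \<open>y\<close> can be taken.\<close>

lemma midpoint_c_transform:
  assumes semiconcave: "\<And>x x' y. \<lbrakk>x \<in> X; x' \<in> X; y \<in> X\<rbrakk> \<Longrightarrow>
      norm (x - y) powr p + norm (x' - y) powr p \<le> 2 * norm ((1/2) *\<^sub>R (x + x') - y) powr p + \<omega> x x'"
    and le: "\<And>x y. \<lbrakk>x \<in> X; y \<in> X\<rbrakk> \<Longrightarrow> f\<^sub>0 x + g\<^sub>0 y \<le> norm (x - y) powr p"
      "\<And>x y. \<lbrakk>x \<in> X; y \<in> X\<rbrakk> \<Longrightarrow> f\<^sub>1 x + g\<^sub>1 y \<le> norm (x - y) powr p"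
    and x: "x \<in> X" "x' \<in> X"
  shows "f\<^sub>0 x + f\<^sub>1 x' \<le> 2 * c_transform X (\<lambda>y. (g\<^sub>0 y + g\<^sub>1 y) / 2) ((1/2) *\<^sub>R (x + x')) + \<omega> x x'"
proof -
  let ?z = "(1/2) *\<^sub>R (x + x')"
  have z: "?z \<in> X" using convexD[OF convex x, of "1/2" "1/2"] by (simp add: scaleR_add_right)
  have "(f\<^sub>0 x + f\<^sub>1 x' - \<omega> x x') / 2 \<le> c_transform X (\<lambda>y. (g\<^sub>0 y + g\<^sub>1 y) / 2) ?z"
  proof (rule c_transform_ge[OF nonempty z])
    fix y assume y: "y \<in> X"
    show "(f\<^sub>0 x + f\<^sub>1 x' - \<omega> x x') / 2 \<le> norm (?z - y) powr p - (g\<^sub>0 y + g\<^sub>1 y) / 2"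
      using semiconcave[OF x y] le(1)[OF x(1) y] le(2)[OF x(2) y] by (simp add: field_simps)
  qed
  then show ?thesis by (simp add: field_simps)
qed

text \<open>In the sum of the two optimality inequalities the common competitor leaves only
  \<open>(g\<^sub>0 - g\<^sub>1) / 2\<close>, integrated against the difference of
  \<open>\<mu>\<close> and \<open>\<nu>\<close>; this function is again
  \<open>L\<close>-Lipschitz.\<close>

lemma dual_gap_le_wasserstein:
  fixes f\<^sub>0 f\<^sub>1 g\<^sub>0 g\<^sub>1 :: "'a \<Rightarrow> real"
  assumes \<rho>: "prob_space \<rho>" "sets \<rho> = sets borel" "AE x in \<rho>. x \<in> X"
    and \<mu>: "borel_prob \<mu>" "AE x in \<mu>. x \<in> X" and \<nu>: "borel_prob \<nu>" "AE x in \<nu>. x \<in> X"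
    and opt: "kantorovich_potentials p \<rho> \<mu> \<phi>\<^sub>0 \<psi>\<^sub>0" "kantorovich_potentials p \<rho> \<nu> \<phi>\<^sub>1 \<psi>\<^sub>1"
    and eq: "(\<integral>x. f\<^sub>0 x \<partial>\<rho>) + (\<integral>y. g\<^sub>0 y \<partial>\<mu>) = ereal_integral \<rho> \<phi>\<^sub>0 + ereal_integral \<mu> \<psi>\<^sub>0"
      "(\<integral>x. f\<^sub>1 x \<partial>\<rho>) + (\<integral>y. g\<^sub>1 y \<partial>\<nu>) = ereal_integral \<rho> \<phi>\<^sub>1 + ereal_integral \<nu> \<psi>\<^sub>1"
    and lip: "L-lipschitz_on UNIV f\<^sub>0" "L-lipschitz_on UNIV f\<^sub>1" "L-lipschitz_on UNIV g\<^sub>0" "L-lipschitz_on UNIV g\<^sub>1"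
  defines "f \<equiv> c_transform X (\<lambda>y. (g\<^sub>0 y + g\<^sub>1 y) / 2)"
  shows "L-lipschitz_on UNIV f"
    and "(\<integral>x. 2 * f x - f\<^sub>0 x - f\<^sub>1 x \<partial>\<rho>) \<le> L * wasserstein 1 \<mu> \<nu>"
proof -
  let ?g = "\<lambda>y. (g\<^sub>0 y + g\<^sub>1 y) / 2" and ?h = "\<lambda>y. (g\<^sub>0 y - g\<^sub>1 y) / 2"
  have half: "L-lipschitz_on UNIV ?g" "L-lipschitz_on UNIV ?h"
  proof -
    have "dist (?g x) (?g y) \<le> L * dist x y" "dist (?h x) (?h y) \<le> L * dist x y" for x y
      using lipschitz_onD[OF lip(3), of x y] lipschitz_onD[OF lip(4), of x y]
      unfolding dist_real_def by (simp_all add: field_simps abs_le_iff)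
    then show "L-lipschitz_on UNIV ?g" "L-lipschitz_on UNIV ?h"
      using L_nonneg by (auto intro!: lipschitz_onI)
  qed
  have bdd: "bdd_above (?g ` X)" by (rule bdd_above_lipschitz_image[OF half(1)])
  show lf: "L-lipschitz_on UNIV f"
    unfolding f_def by (rule c_transform_lipschitz[OF bdd nonempty order_refl])
  have fg: "f x + ?g y \<le> norm (x - y) powr p" if "x \<in> X" "y \<in> X" for x y
    using c_transform_le[OF bdd that] by (simp add: f_def)
  have m: "prob_space \<mu>" "sets \<mu> = sets borel" "prob_space \<nu>" "sets \<nu> = sets borel"
    using \<mu> \<nu> by (auto simp: borel_prob_def)
  note c = lipschitz_on_continuous_on
  have le: "(\<integral>x. f x \<partial>\<rho>) + (\<integral>y. ?g y \<partial>\<mu>) \<le> (\<integral>x. f\<^sub>0 x \<partial>\<rho>) + (\<integral>y. g\<^sub>0 y \<partial>\<mu>)"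
    "(\<integral>x. f x \<partial>\<rho>) + (\<integral>y. ?g y \<partial>\<nu>) \<le> (\<integral>x. f\<^sub>1 x \<partial>\<rho>) + (\<integral>y. g\<^sub>1 y \<partial>\<nu>)"
    unfolding eq using dual_value_le[OF \<rho> m(1,2) \<mu>(2) opt(1) c[OF lf] c[OF half(1)] fg]
      dual_value_le[OF \<rho> m(3,4) \<nu>(2) opt(2) c[OF lf] c[OF half(1)] fg] by auto
  note i\<rho> = truncated_potential(4)[OF \<rho> c] and i\<mu> = truncated_potential(4)[OF m(1,2) \<mu>(2) c]
    and i\<nu> = truncated_potential(4)[OF m(3,4) \<nu>(2) c]
  obtain R where R: "X \<subseteq> cball 0 R" using X_cball by blast
  have AE: "AE x in \<mu>. norm x \<le> R" "AE x in \<nu>. norm x \<le> R"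
    using \<mu>(2) \<nu>(2) R by (auto simp: subset_iff)
  have "(\<integral>x. 2 * f x - f\<^sub>0 x - f\<^sub>1 x \<partial>\<rho>) = 2 * (\<integral>x. f x \<partial>\<rho>) - (\<integral>x. f\<^sub>0 x \<partial>\<rho>) - (\<integral>x. f\<^sub>1 x \<partial>\<rho>)"
    using i\<rho>[OF lf] i\<rho>[OF lip(1)] i\<rho>[OF lip(2)] by simp
  also have "\<dots> \<le> (\<integral>y. g\<^sub>0 y \<partial>\<mu>) - (\<integral>y. ?g y \<partial>\<mu>) + (\<integral>y. g\<^sub>1 y \<partial>\<nu>) - (\<integral>y. ?g y \<partial>\<nu>)"
    using le by simp
  also have "\<dots> = (\<integral>y. ?h y \<partial>\<mu>) - (\<integral>y. ?h y \<partial>\<nu>)"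
    using i\<mu>[OF lip(3)] i\<mu>[OF lip(4)] i\<nu>[OF lip(3)] i\<nu>[OF lip(4)] by (simp add: field_simps)
  also have "\<dots> \<le> L * wasserstein 1 \<mu> \<nu>"
    by (rule lipschitz_integral_diff_le_wasserstein[OF \<mu>(1) \<nu>(1) AE half(2)])
  finally show "(\<integral>x. 2 * f x - f\<^sub>0 x - f\<^sub>1 x \<partial>\<rho>) \<le> L * wasserstein 1 \<mu> \<nu>" .
qed

end

lemma integral_density_bounds:
  fixes f u :: "'a \<Rightarrow> real"
  assumes [measurable]: "f \<in> borel_measurable M" and f: "AE x in M. a \<le> f x \<and> f x \<le> b" "0 < a"
    and u: "integrable M u" "AE x in M. 0 \<le> u x"
  shows "a * (\<integral>x. u x \<partial>M) \<le> (\<integral>x. u x \<partial>density M (\<lambda>x. ennreal (f x)))"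
    and "(\<integral>x. u x \<partial>density M (\<lambda>x. ennreal (f x))) \<le> b * (\<integral>x. u x \<partial>M)"
proof -
  have [measurable]: "u \<in> borel_measurable M" using u by auto
  have eq: "(\<integral>x. u x \<partial>density M (\<lambda>x. ennreal (f x))) = (\<integral>x. f x * u x \<partial>M)"
    using f by (subst integral_density) auto
  have le: "AE x in M. a * u x \<le> f x * u x" "AE x in M. f x * u x \<le> b * u x"
    using f u(2) by (auto intro: mult_right_mono)
  have int: "integrable M (\<lambda>x. f x * u x)"
  proof (rule Bochner_Integration.integrable_bound)
    show "integrable M (\<lambda>x. b * u x)" using u by simp
    show "AE x in M. norm (f x * u x) \<le> norm (b * u x)"
      using f(1) u(2)
    proof eventually_elim
      case (elim x)
      then show ?case using f(2) by (auto simp: abs_mult intro!: mult_right_mono)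
    qed
  qed measurable
  show "a * (\<integral>x. u x \<partial>M) \<le> (\<integral>x. u x \<partial>density M (\<lambda>x. ennreal (f x)))"
    unfolding eq integral_mult_right_zero[symmetric] using le int u by (intro integral_mono_AE) auto
  show "(\<integral>x. u x \<partial>density M (\<lambda>x. ennreal (f x))) \<le> b * (\<integral>x. u x \<partial>M)"
    unfolding eq integral_mult_right_zero[symmetric] using le int u by (intro integral_mono_AE) auto
qed

text \<open>The mean is the best constant in the mean square. This removes the centring
  \<open>m\<close> of the variance bound, which comes from a Gibbs measure and not from
  \<open>\<rho>\<close>.\<close>

lemma (in prob_space) second_moment_le_of_mean_zero:
  fixes w :: "'a \<Rightarrow> real"
  assumes "integrable M w" "integrable M (\<lambda>x. (w x)\<^sup>2)" "(\<integral>x. w x \<partial>M) = 0"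
  shows "(\<integral>x. (w x)\<^sup>2 \<partial>M) \<le> (\<integral>x. (w x - m)\<^sup>2 \<partial>M)"
proof -
  have "(\<integral>x. (w x - m)\<^sup>2 \<partial>M) = (\<integral>x. (w x)\<^sup>2 - 2 * m * w x + m\<^sup>2 \<partial>M)"
    by (simp add: power2_diff algebra_simps)
  also have "\<dots> = (\<integral>x. (w x)\<^sup>2 \<partial>M) + m\<^sup>2" using assms by (simp add: prob_space)
  finally show ?thesis by simp
qed

theorem theorem1p1:
  fixes lam \<rho> :: "'a::euclidean_space measure" and Y :: "'a set" and p :: real
  assumes "prob_space lam" and "log_concave_measure lam" and "bounded (measure_support lam)"
    and "prob_space \<rho>" and "has_density_bounded_above_below lam \<rho>"
    and "compact Y" and "p > 1"
  shows "\<exists>C::real. \<forall>\<mu> \<nu> \<phi>\<^sub>\<mu> \<psi>\<^sub>\<mu> \<phi>\<^sub>\<nu> \<psi>\<^sub>\<nu>.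
     borel_prob \<mu> \<and> measure_support \<mu> \<subseteq> Y \<and>
     borel_prob \<nu> \<and> measure_support \<nu> \<subseteq> Y \<and>
     kantorovich_potentials p \<rho> \<mu> \<phi>\<^sub>\<mu> \<psi>\<^sub>\<mu> \<and> ereal_integral \<rho> \<phi>\<^sub>\<mu> = 0 \<and>
     kantorovich_potentials p \<rho> \<nu> \<phi>\<^sub>\<nu> \<psi>\<^sub>\<nu> \<and> ereal_integral \<rho> \<phi>\<^sub>\<nu> = 0 \<longrightarrow>
     square_integrable \<rho> (\<lambda>x. real_of_ereal (\<phi>\<^sub>\<mu> x) - real_of_ereal (\<phi>\<^sub>\<nu> x)) \<and>
     L2_norm \<rho> (\<lambda>x. real_of_ereal (\<phi>\<^sub>\<mu> x) - real_of_ereal (\<phi>\<^sub>\<nu> x))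
       \<le> C * wasserstein 1 \<mu> \<nu> powr (if p < 2 then 1 - 1 / p else 1 / 2)"
proof -
  interpret lam: prob_space lam by fact
  interpret \<rho>: prob_space \<rho> by fact
  have sets_lam: "sets lam = sets borel" by (rule log_concave_measure_sets) fact
  note [measurable_cong] = sets_lam
  obtain d a b where a: "0 < a" and b: "0 < b" and d: "d \<in> borel_measurable lam"
    "\<rho> = density lam (\<lambda>x. ennreal (d x))" "AE x in lam. a \<le> d x \<and> d x \<le> b"
    using assms(5) unfolding has_density_bounded_above_below_def by blast
  have sets_\<rho>: "sets \<rho> = sets borel" using d(2) sets_lam by simp
  obtain R where R: "0 < R" "measure_support lam \<subseteq> cball 0 R" "Y \<subseteq> cball 0 R"
  proof -
    have "bounded (measure_support lam \<union> Y)" using assms(3,6) by (simp add: compact_imp_bounded)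
    then obtain R where "0 < R" "\<forall>x\<in>measure_support lam \<union> Y. norm x \<le> R" unfolding bounded_pos by blast
    then show ?thesis by (intro that[of R]) auto
  qed
  have AE_lam: "AE x in lam. norm x \<le> R"
    using AE_in_measure_support[OF sets_lam] R(2) by (auto simp: subset_iff)
  have AE_\<rho>: "AE x in \<rho>. norm x \<le> R"
    unfolding d(2) using d(1) AE_lam by (subst AE_density) auto
  \<comment> \<open>The cost is evaluated at differences of points of the ball, hence the radius
    \<open>2 * R\<close> in \<open>L\<close> and \<open>C\<^sub>1\<close>.\<close>
  have diam: "norm (x - y) \<le> 2 * R" if "norm x \<le> R" "norm y \<le> R" for x y :: 'a
    using norm_triangle_ineq4[of x y] that by linarith
  have R2: "0 < 2 * R" using R by simp
  obtain L where L: "0 < L" "\<And>x y :: 'a. norm x \<le> 2 * R \<Longrightarrow> norm y \<le> 2 * R \<Longrightarrow>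
      \<bar>norm x powr p - norm y powr p\<bar> \<le> L * norm (x - y)"
    using norm_powr_lipschitz[OF \<open>p > 1\<close> R2, where 'a='a] by blast
  define q where "q = min p 2"
  have q: "1 < q" "q \<le> 2" using \<open>p > 1\<close> by (auto simp: q_def)
  obtain C\<^sub>1 where C1: "0 < C\<^sub>1" "\<And>x x' y :: 'a. norm (x - y) \<le> 2 * R \<Longrightarrow> norm (x' - y) \<le> 2 * R \<Longrightarrow>
      norm (x - y) powr p + norm (x' - y) powr p
        \<le> 2 * norm ((1/2) *\<^sub>R (x + x') - y) powr p + C\<^sub>1 * norm (x - x') powr q"
    using norm_powr_semiconcave[OF \<open>p > 1\<close> R2, where 'a='a] unfolding q_def by blast
  define \<theta> where "\<theta> = 1 - 1 / q"
  have \<theta>: "(if p < 2 then 1 - 1 / p else 1 / 2) = \<theta>" "0 < \<theta>"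
    using q by (auto simp: \<theta>_def q_def min_def)
  interpret power_cost p L "cball 0 R :: 'a set"
  proof
    fix x x' y :: 'a assume "x \<in> cball 0 R" "x' \<in> cball 0 R" "y \<in> cball 0 R"
    then show "norm (x - y) powr p \<le> norm (x' - y) powr p + L * norm (x - x')"
      using L(2)[of "x - y" "x' - y"] diam[of x y] diam[of x' y] by (simp add: abs_le_iff)
  qed (use R(1) L(1) in auto)
  \<comment> \<open>The largest scale that occurs: \<open>\<epsilon>\<close> will be the
    \<open>q\<close>-th root of a number not exceeding the diameter \<open>2 * R\<close>.\<close>
  from semiconcave_variance_bound[OF assms(1,2) AE_lam less_imp_le[OF R(1)] less_imp_le[OF L(1)] C1(1) q,
      of "(2 * R) powr (1 / q)"]
  obtain C where C: "\<And>f\<^sub>0 f\<^sub>1 f \<epsilon>. 0 < \<epsilon> \<Longrightarrow> \<epsilon> \<le> (2 * R) powr (1 / q) \<Longrightarrow>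
    L-lipschitz_on UNIV f\<^sub>0 \<Longrightarrow> L-lipschitz_on UNIV f\<^sub>1 \<Longrightarrow> L-lipschitz_on UNIV f \<Longrightarrow>
    \<forall>x y. norm x \<le> R \<longrightarrow> norm y \<le> R \<longrightarrow>
      f\<^sub>0 x + f\<^sub>1 y \<le> 2 * f ((1/2) *\<^sub>R (x + y)) + C\<^sub>1 * norm (x - y) powr q \<Longrightarrow>
    \<exists>m. (\<integral>x. (f\<^sub>0 x - f\<^sub>1 x - m)\<^sup>2 \<partial>lam)
      \<le> C * (\<epsilon> powr (q - 2) * (\<integral>x. 2 * f x - f\<^sub>0 x - f\<^sub>1 x \<partial>lam) + \<epsilon> powr (2 * q - 2))"
    by (elim exE) blast
  \<comment> \<open>\<open>L / a\<close> bounds the gap under \<open>lam\<close> relative to the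
    Wasserstein distance, 1 stands for the error term, and \<open>b\<close> passes from
    \<open>lam\<close> to \<open>\<rho>\<close>; \<open>C\<close> comes without a sign, hence the
    maximum.\<close>
  define K where "K = b * (max C 0 * (L / a + 1))"
  have K0: "0 \<le> K" using a b L by (simp add: K_def)
  show ?thesis
  proof (rule exI[of _ "sqrt K"], intro allI impI, elim conjE)
    fix \<mu> \<nu> :: "'a measure" and \<phi>\<^sub>0 \<psi>\<^sub>0 \<phi>\<^sub>1 \<psi>\<^sub>1 :: "'a \<Rightarrow> ereal"
    assume \<mu>: "borel_prob \<mu>" "measure_support \<mu> \<subseteq> Y" and \<nu>: "borel_prob \<nu>" "measure_support \<nu> \<subseteq> Y"
      and opt: "kantorovich_potentials p \<rho> \<mu> \<phi>\<^sub>0 \<psi>\<^sub>0" "kantorovich_potentials p \<rho> \<nu> \<phi>\<^sub>1 \<psi>\<^sub>1"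
      and zero: "ereal_integral \<rho> \<phi>\<^sub>0 = 0" "ereal_integral \<rho> \<phi>\<^sub>1 = 0"
    have ms: "prob_space \<mu>" "sets \<mu> = sets borel" "prob_space \<nu>" "sets \<nu> = sets borel"
      using \<mu> \<nu> by (auto simp: borel_prob_def)
    have AE: "AE x in \<mu>. x \<in> cball 0 R" "AE x in \<nu>. x \<in> cball 0 R" "AE x in \<rho>. x \<in> cball 0 R"
      using AE_in_measure_support[OF ms(2)] AE_in_measure_support[OF ms(4)] \<mu>(2) \<nu>(2) R(3) AE_\<rho>
      by (auto simp: subset_iff)
    note \<rho>s = \<rho>.prob_space_axioms sets_\<rho> AE(3)
    obtain f0 g0 where l0: "L-lipschitz_on UNIV f0" "L-lipschitz_on UNIV g0"
      and fg0: "\<And>x y. x \<in> cball 0 R \<Longrightarrow> y \<in> cball 0 R \<Longrightarrow> f0 x + g0 y \<le> norm (x - y) powr p"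
      and ae0: "AE x in \<rho>. real_of_ereal (\<phi>\<^sub>0 x) = f0 x"
      and eq0: "(\<integral>x. f0 x \<partial>\<rho>) + (\<integral>y. g0 y \<partial>\<mu>) = ereal_integral \<rho> \<phi>\<^sub>0 + ereal_integral \<mu> \<psi>\<^sub>0"
      using lipschitz_potentials[OF \<rho>s ms(1,2) AE(1) opt(1)] by blast
    obtain f1 g1 where l1: "L-lipschitz_on UNIV f1" "L-lipschitz_on UNIV g1"
      and fg1: "\<And>x y. x \<in> cball 0 R \<Longrightarrow> y \<in> cball 0 R \<Longrightarrow> f1 x + g1 y \<le> norm (x - y) powr p"
      and ae1: "AE x in \<rho>. real_of_ereal (\<phi>\<^sub>1 x) = f1 x"
      and eq1: "(\<integral>x. f1 x \<partial>\<rho>) + (\<integral>y. g1 y \<partial>\<nu>) = ereal_integral \<rho> \<phi>\<^sub>1 + ereal_integral \<nu> \<psi>\<^sub>1"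
      using lipschitz_potentials[OF \<rho>s ms(3,4) AE(2) opt(2)] by blast
    define f where "f = c_transform (cball 0 R) (\<lambda>y. (g0 y + g1 y) / 2)"
    define W where "W = wasserstein 1 \<mu> \<nu>"
    define w where "w x = f0 x - f1 x" for x
    let ?\<phi> = "\<lambda>x. real_of_ereal (\<phi>\<^sub>0 x) - real_of_ereal (\<phi>\<^sub>1 x)"
    note gap = dual_gap_le_wasserstein[OF \<rho>s \<mu>(1) AE(1) \<nu>(1) AE(2) opt eq0 eq1 l0(1) l1(1) l0(2) l1(2),
        folded f_def W_def]
    have mid: "f0 x + f1 y \<le> 2 * f ((1/2) *\<^sub>R (x + y)) + C\<^sub>1 * norm (x - y) powr q"
      if "norm x \<le> R" "norm y \<le> R" for x y
      unfolding f_def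
    proof (rule midpoint_c_transform[OF _ fg0 fg1])
      fix x x' y :: 'a assume "x \<in> cball 0 R" "x' \<in> cball 0 R" "y \<in> cball 0 R"
      then show "norm (x - y) powr p + norm (x' - y) powr p
        \<le> 2 * norm ((1/2) *\<^sub>R (x + x') - y) powr p + C\<^sub>1 * norm (x - x') powr q"
        using diam by (intro C1(2)) auto
    qed (use that in auto)
    note cont [continuous_intros] = l0(1)[THEN lipschitz_on_continuous_on] l1(1)[THEN lipschitz_on_continuous_on]
      gap(1)[THEN lipschitz_on_continuous_on]
    have cD: "continuous_on UNIV (\<lambda>x. 2 * f x - f0 x - f1 x)" by (intro continuous_intros)
    have cw: "continuous_on UNIV w" unfolding w_def by (intro continuous_intros)
    have [measurable]: "w \<in> borel_measurable borel" using cw by (rule borel_measurable_continuous_onI)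
    have int_lam: "integrable lam u" and int_\<rho>: "integrable \<rho> u" if "continuous_on UNIV u" for u :: "'a \<Rightarrow> real"
      using that AE_lam AE_\<rho> sets_lam sets_\<rho>
      by (auto intro: integrable_of_continuous simp: lam.finite_measure_axioms \<rho>.finite_measure_axioms)
    have iw: "integrable \<rho> w" "integrable \<rho> (\<lambda>x. (w x)\<^sup>2)" using cw by (auto intro!: int_\<rho> continuous_intros)
    have meas\<phi>: "?\<phi> \<in> borel_measurable \<rho>"
      using opt by (auto simp: kantorovich_potentials_def admissible_pair_def ereal_integrable_def)
    have \<phi>w: "AE x in \<rho>. ?\<phi> x = w x" using ae0 ae1 by (auto simp: w_def)
    have w\<rho>: "w \<in> borel_measurable \<rho>" using iw by auto
    have "(\<integral>x. ?\<phi> x \<partial>\<rho>) = 0"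
      using opt zero
      by (auto simp: kantorovich_potentials_def admissible_pair_def ereal_integrable_def ereal_integral_def)
    moreover have "(\<integral>x. ?\<phi> x \<partial>\<rho>) = (\<integral>x. w x \<partial>\<rho>)"
      using \<phi>w meas\<phi> w\<rho> by (intro integral_cong_AE) auto
    ultimately have w0: "(\<integral>x. w x \<partial>\<rho>) = 0" by simp
    have sq: "(\<integral>x. (?\<phi> x)\<^sup>2 \<partial>\<rho>) = (\<integral>x. (w x)\<^sup>2 \<partial>\<rho>)"
      using \<phi>w meas\<phi> w\<rho> by (intro integral_cong_AE) auto
    have "square_integrable \<rho> ?\<phi>"
      unfolding square_integrable_def using meas\<phi> w\<rho> \<phi>w iw(2)
      by (auto intro: integrable_cong_AE_imp)
    moreover have "sqrt (\<integral>x. (w x)\<^sup>2 \<partial>\<rho>) \<le> sqrt K * W powr \<theta>"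
    proof -
      have W: "0 \<le> W" "W \<le> 2 * R"
        unfolding W_def using AE by (auto intro!: wasserstein_nonneg wasserstein_one_le_diameter \<mu>(1) \<nu>(1))
      \<comment> \<open>The scale has to be positive, so \<open>W\<close> is replaced by any
        positive \<open>s \<ge> W\<close>; for \<open>W = 0\<close> one lets \<open>s\<close> tend
        to 0.\<close>
      have bound: "sqrt (\<integral>x. (w x)\<^sup>2 \<partial>\<rho>) \<le> sqrt K * s powr \<theta>" if s: "0 < s" "W \<le> s" "s \<le> 2 * R" for s
      proof -
        \<comment> \<open>The scale at which \<open>\<epsilon> powr (q - 2) * s\<close> and
          \<open>\<epsilon> powr (2 * q - 2)\<close> coincide.\<close>
        define \<epsilon> where "\<epsilon> = s powr (1 / q)"
        have \<epsilon>: "0 < \<epsilon>" "\<epsilon> \<le> (2 * R) powr (1 / q)"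
          unfolding \<epsilon>_def using s q by (auto intro!: powr_mono2)
        have \<epsilon>1: "\<epsilon> powr (2 * q - 2) = s powr (2 * \<theta>)"
          using q by (simp add: \<epsilon>_def \<theta>_def powr_powr field_simps)
        have \<epsilon>2: "\<epsilon> powr (q - 2) * s = s powr (2 * \<theta>)"
        proof -
          have "\<epsilon> powr (q - 2) * s = s powr ((q - 2) / q) * s powr 1"
            using s by (simp add: \<epsilon>_def powr_powr)
          also have "\<dots> = s powr ((q - 2) / q + 1)" by (rule powr_add[symmetric])
          also have "(q - 2) / q + 1 = 2 * \<theta>" using q by (simp add: \<theta>_def field_simps)
          finally show ?thesis .
        qed
        let ?D = "\<lambda>x. 2 * f x - f0 x - f1 x"
        obtain m where m: "(\<integral>x. (w x - m)\<^sup>2 \<partial>lam)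
            \<le> C * (\<epsilon> powr (q - 2) * (\<integral>x. ?D x \<partial>lam) + \<epsilon> powr (2 * q - 2))"
          using C[OF \<epsilon> l0(1) l1(1) gap(1)] mid unfolding w_def by blast
        have D0: "AE x in lam. 0 \<le> ?D x" using AE_lam
        proof eventually_elim
          case (elim x)
          then show ?case using mid[of x x] by (simp add: scaleR_2[symmetric])
        qed
        have "a * (\<integral>x. ?D x \<partial>lam) \<le> (\<integral>x. ?D x \<partial>\<rho>)"
          unfolding d(2) by (rule integral_density_bounds(1)[OF d(1,3) a int_lam[OF cD] D0])
        also have "\<dots> \<le> L * s" using gap(2) mult_left_mono[OF s(2), of L] L(1) by linarith
        finally have "(\<integral>x. ?D x \<partial>lam) \<le> L / a * s" using a by (simp add: field_simps)
        then have "\<epsilon> powr (q - 2) * (\<integral>x. ?D x \<partial>lam) \<le> \<epsilon> powr (q - 2) * (L / a * s)"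
          by (rule mult_left_mono) simp
        also have "\<dots> = L / a * s powr (2 * \<theta>)" unfolding \<epsilon>2[symmetric] by simp
        finally have le: "\<epsilon> powr (q - 2) * (\<integral>x. ?D x \<partial>lam) + \<epsilon> powr (2 * q - 2) \<le> (L / a + 1) * s powr (2 * \<theta>)"
          unfolding \<epsilon>1 by (simp add: algebra_simps)
        have "0 \<le> (\<integral>x. ?D x \<partial>lam)" using D0 by (rule integral_nonneg_AE)
        then have nn: "0 \<le> \<epsilon> powr (q - 2) * (\<integral>x. ?D x \<partial>lam) + \<epsilon> powr (2 * q - 2)" by simp
        note m
        also have "C * (\<epsilon> powr (q - 2) * (\<integral>x. ?D x \<partial>lam) + \<epsilon> powr (2 * q - 2))
            \<le> max C 0 * ((L / a + 1) * s powr (2 * \<theta>))"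
          using le nn by (intro mult_mono) auto
        finally have var: "(\<integral>x. (w x - m)\<^sup>2 \<partial>lam) \<le> max C 0 * ((L / a + 1) * s powr (2 * \<theta>))" .
        \<comment> \<open>The constant \<open>m\<close> is brought in under \<open>\<rho>\<close>,
          where \<open>w\<close> has mean zero, before changing to \<open>lam\<close>, where the
          variance bound holds.\<close>
        have "(\<integral>x. (w x)\<^sup>2 \<partial>\<rho>) \<le> (\<integral>x. (w x - m)\<^sup>2 \<partial>\<rho>)"
          by (rule \<rho>.second_moment_le_of_mean_zero[OF iw w0])
        also have "\<dots> \<le> b * (\<integral>x. (w x - m)\<^sup>2 \<partial>lam)"
          unfolding d(2)
          by (rule integral_density_bounds(2)[OF d(1,3) a]) (auto intro!: int_lam continuous_intros cw)
        also have "\<dots> \<le> b * (max C 0 * ((L / a + 1) * s powr (2 * \<theta>)))"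
          using var b by (intro mult_left_mono) auto
        also have "\<dots> = K * s powr (2 * \<theta>)" by (simp add: K_def)
        finally have "sqrt (\<integral>x. (w x)\<^sup>2 \<partial>\<rho>) \<le> sqrt (K * s powr (2 * \<theta>))" by simp
        also have "\<dots> = sqrt K * s powr \<theta>"
          using s by (simp add: real_sqrt_mult powr_half_sqrt[symmetric] powr_powr)
        finally show ?thesis .
      qed
      show ?thesis
      proof (cases "W = 0")
        case False
        then show ?thesis using bound[of W] W by simp
      next
        case True
        have nonneg: "\<forall>\<^sub>F s in at_right 0. 0 \<le> (s :: real)"
          using eventually_at_right_less[of "0 :: real"] by eventually_elim simp
        have "((\<lambda>s. sqrt K * s powr \<theta>) \<longlongrightarrow> sqrt K * 0) (at_right 0)"
          using \<theta>(2) nonneg by (intro tendsto_mult tendsto_const tendsto_zero_powrI[where b=\<theta>]) auto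
        moreover have "\<forall>\<^sub>F s in at_right 0. sqrt (\<integral>x. (w x)\<^sup>2 \<partial>\<rho>) \<le> sqrt K * s powr \<theta>"
          unfolding eventually_at_right_field using R2 True bound by (metis less_imp_le)
        ultimately have "sqrt (\<integral>x. (w x)\<^sup>2 \<partial>\<rho>) \<le> sqrt K * 0"
          by (intro tendsto_lowerbound) auto
        then show ?thesis using True by simp
      qed
    qed
    ultimately show "square_integrable \<rho> ?\<phi> \<and> L2_norm \<rho> ?\<phi>
      \<le> sqrt K * wasserstein 1 \<mu> \<nu> powr (if p < 2 then 1 - 1 / p else 1 / 2)"
      unfolding L2_norm_def sq \<theta>(1) W_def by blast
  qed
qed

end
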